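(* Let $(\bar A,\bar B)$ be a structural pair, where $\bar A\in\{0,\star\}^{n\times n}$ is symmetrically structured and $\bar B\in\{0,\star\}^{n\times m}$ is structured. Let $\mathcal D(\bar A,\bar B)=(\mathcal X\cup\mathcal U,\mathcal E_{\mathcal X,\mathcal X}\cup\mathcal E_{\mathcal U,\mathcal X})$ be the associated digraph, and let $\mathcal X_r\subseteq\mathcal X$ and $\mathcal X_u\subseteq\mathcal X$ be the subsets of state vertices which are input-reachable and input-unreachable, respectively. Then $(\bar A,\bar B)$ is structurally stabilizable if and only if the following two conditions hold simultaneously in $\mathcal D(\bar A,\bar B)$: (1) every vertex $x_i\in\mathcal X_u$ has a self-loop; (2) $|\mathcal N(\mathcal S)|\ge|\mathcal S|$ for every $\mathcal S\subseteq\mathcal X_r$.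
   Context: A structured matrix $\bar M\in\{0,\star\}^{n\times m}$ is a matrix each of whose entries is either a fixed zero or an independent free real parameter, denoted $\star$. A matrix $\bar M\in\{0,\star\}^{n\times n}$ is symmetrically structured if its zero/star pattern is symmetric and the free parameter at position $(j,i)$ is constrained to have the same value as the one at position $(i,j)$, for all $i,j$. A numerical realization $\tilde M$ of $\bar M$ is a real matrix obtained by assigning real numbers to the $\star$-parameters (so a realization of a symmetrically structured matrix is a symmetric real matrix). A numerical realization of $(\bar A,\bar B)$ is a pair $(\tilde A,\tilde B)$ of numerical realizations of $\bar A$ and $\bar B$. A pair $(\tilde A,\tilde B)$ is identified with the continuous-time LTI system $\dot x=\tilde A x+\tilde B u$; it is stabilizable if every uncontrollable eigenvalue of $\tilde A$ has negative real part. The pair $(\bar A,\bar B)$ is structurally stabilizable if there exists a stabilizable numerical realization $(\tilde A,\tilde B)$. The digraph $\mathcal D(\bar A,\bar B)$ has state vertices $\mathcal X=\{x_1,\dots,x_n\}$, input vertices $\mathcal U=\{u_1,\dots,u_m\}$, and edges $\mathcal E_{\mathcal X,\mathcal X}=\{(x_j,x_i):[\bar A]_{ij}=\star\}$ and $\mathcal E_{\mathcal U,\mathcal X}=\{(u_j,x_i):[\bar B]_{ij}=\star\}$. A self-loop at $x_i$ is the edge $(x_i,x_i)$. A state vertex is input-reachable if there is a directed path to it from some input vertex, and input-unreachable otherwise. For $\mathcal S\subseteq\mathcal X$, $\mathcal N(\mathcal S)=\{v\in\mathcal X\cup\mathcal U:(v,w)\in\mathcal E_{\mathcal X,\mathcal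 X}\cup\mathcal E_{\mathcal U,\mathcal X}\text{ for some }w\in\mathcal S\}$ is the in-neighbour set of $\mathcal S$. *)

theory Defs
  imports Complex_Main "Jordan_Normal_Form.Char_Poly"
begin

datatype entry = Zero | Star

definition symmetrically_structured :: "entry mat \<Rightarrow> bool" where
  "symmetrically_structured M \<longleftrightarrow> square_mat M \<and> transpose_mat M = M"

definition realization :: "entry mat \<Rightarrow> real mat \<Rightarrow> bool" where
  "realization M R \<longleftrightarrow>
     R \<in> carrier_mat (dim_row M) (dim_col M) \<and>
     (\<forall>i < dim_row M. \<forall>j < dim_col M. M $$ (i, j) = Zero \<longrightarrow> R $$ (i, j) = 0)"

text \<open>In a symmetrically structured matrix the parameters at \<open>(i, j)\<close> and \<open>(j, i)\<close> are one and
  the same, so its realizations are exactly the symmetric matrices respecting the pattern.\<close>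

definition symmetric_realization :: "entry mat \<Rightarrow> real mat \<Rightarrow> bool" where
  "symmetric_realization M R \<longleftrightarrow> realization M R \<and> transpose_mat R = R"

abbreviation complex_mat :: "real mat \<Rightarrow> complex mat" where
  "complex_mat \<equiv> map_mat complex_of_real"

text \<open>An eigenvalue \<open>z\<close> of \<open>A\<close> is uncontrollable if some left eigenvector of \<open>A\<close> for \<open>z\<close> is
  annihilated by \<open>B\<close>, that is, if \<open>[A - z I, B]\<close> does not have full row rank. Left
  eigenvectors are written as eigenvectors of the transpose; requiring the equations for the
  conjugate transpose of the vector instead amounts to replacing the vector by its conjugate.
  Eigenvalues and eigenvectors are complex.\<close>

definition uncontrollable_eigenvalue :: "real mat \<Rightarrow> real mat \<Rightarrow> complex \<Rightarrow> bool" where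
  "uncontrollable_eigenvalue A B z \<longleftrightarrow>
     eigenvalue (complex_mat A) z \<and>
     (\<exists>v. eigenvector (transpose_mat (complex_mat A)) v z \<and>
          transpose_mat (complex_mat B) *\<^sub>v v = 0\<^sub>v (dim_col B))"

definition stabilizable :: "real mat \<Rightarrow> real mat \<Rightarrow> bool" where
  "stabilizable A B \<longleftrightarrow> (\<forall>z. uncontrollable_eigenvalue A B z \<longrightarrow> Re z < 0)"

text \<open>Here \<open>A\<close> is meant to be symmetrically structured and \<open>B\<close> to be structured.\<close>

definition structurally_stabilizable :: "entry mat \<Rightarrow> entry mat \<Rightarrow> bool" where
  "structurally_stabilizable A B \<longleftrightarrow>
     (\<exists>A' B'. symmetric_realization A A' \<and> realization B B' \<and> stabilizable A' B')"

text \<open>Vertices are numbered from \<open>0\<close>, like the rows and columns of matrices.\<close>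

datatype vertex = State nat | Input nat

definition state_vertices :: "entry mat \<Rightarrow> vertex set" where
  "state_vertices A = State ` {..<dim_row A}"

definition input_vertices :: "entry mat \<Rightarrow> vertex set" where
  "input_vertices B = Input ` {..<dim_col B}"

definition state_edges :: "entry mat \<Rightarrow> (vertex \<times> vertex) set" where
  "state_edges A =
     {(State j, State i) | i j. i < dim_row A \<and> j < dim_col A \<and> A $$ (i, j) = Star}"

definition input_edges :: "entry mat \<Rightarrow> (vertex \<times> vertex) set" where
  "input_edges B =
     {(Input j, State i) | i j. i < dim_row B \<and> j < dim_col B \<and> B $$ (i, j) = Star}"

definition edges :: "entry mat \<Rightarrow> entry mat \<Rightarrow> (vertex \<times> vertex) set" where
  "edges A B = state_edges A \<union> input_edges B"

definition input_reachable :: "entry mat \<Rightarrow> entry mat \<Rightarrow> vertex set" where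
  "input_reachable A B =
     {x \<in> state_vertices A. \<exists>u \<in> input_vertices B. (u, x) \<in> (edges A B)\<^sup>*}"

definition input_unreachable :: "entry mat \<Rightarrow> entry mat \<Rightarrow> vertex set" where
  "input_unreachable A B = state_vertices A - input_reachable A B"

definition in_neighbours :: "entry mat \<Rightarrow> entry mat \<Rightarrow> vertex set \<Rightarrow> vertex set" where
  "in_neighbours A B S =
     {v \<in> state_vertices A \<union> input_vertices B. \<exists>w \<in> S. (v, w) \<in> edges A B}"

end

theory Submission
  imports Defs "HOL-Analysis.Function_Topology"
begin

text \<open>
  By symmetry of \<open>A\<close> the reachable and the unreachable states do not interact.

  Necessity. If the unreachable state \<open>i\<close> has no self-loop, the unreachable block of a realization
  is a symmetric matrix with a zero on its diagonal, so its largest eigenvalue is nonnegative; it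
  is uncontrollable. If \<open>|N(S)| < |S|\<close>, the rows of \<open>[A, B]\<close> in \<open>S\<close> are linearly dependent, so
  \<open>0\<close> is an uncontrollable eigenvalue.

  Sufficiency. Put \<open>-1\<close> on the diagonal of the unreachable block. On the reachable block we make
  all eigenvalues controllable. Hall's theorem gives an injection \<open>f\<close> from reachable states
  to in-neighbours, and \<open>f\<close> decomposes the reachable states into paths ending in distinct inputs and
  cycles. The paths with unit weights are controllable. Cycles are added one at a time, each linked
  by one edge at a vertex \<open>c\<close> to the part \<open>V\<close> built so far or to an input, with all weights of the
  cycle scaled by \<open>s\<close>. An uncontrollable eigenvector of the enlarged system cannot vanish at \<open>c\<close>;
  hence its eigenvalue is a zero of the transfer function from the link to the outputs of \<open>V\<close>. There are
  finitely many such zeros, independently of \<open>s\<close>, and each of them is excluded by all but finitely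
  many \<open>s\<close> because the matrix of the cycle is nonsingular.
\<close>

subsection \<open>Linear systems over finite index sets\<close>

text \<open>Elimination: an equation with a nonzero coefficient is solved for one unknown, which
  leaves one equation and one unknown fewer.\<close>

lemma homogeneous_system_nontrivial:
  fixes a :: "'e \<Rightarrow> 'u \<Rightarrow> 'f :: field"
  assumes "finite E" "finite U" "card E < card U"
  shows "\<exists>c. (\<exists>u\<in>U. c u \<noteq> 0) \<and> (\<forall>e\<in>E. (\<Sum>u\<in>U. a e u * c u) = 0)"
  using assms
proof (induction E arbitrary: U a rule: finite_induct)
  case empty
  then have "U \<noteq> {}" by auto
  then show ?case by (intro exI[of _ "\<lambda>_. 1"]) auto
next
  case (insert e E)
  show ?case
  proof (cases "\<forall>u\<in>U. a e u = 0")
    case True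
    have "card E < card U" using insert by simp
    from insert.IH[OF \<open>finite U\<close> this, of a] True show ?thesis by force
  next
    case False
    then obtain w where w: "w \<in> U" "a e w \<noteq> 0" by blast
    have cU: "card E < card (U - {w})" using insert w by simp
    \<comment> \<open>The coefficients left after \<open>w\<close> has been eliminated by means of
      equation \<open>e\<close>.\<close>
    from insert.IH[OF _ cU, of "\<lambda>d u. a d u - a d w * a e u / a e w"] insert.prems
    obtain c where c: "\<exists>u\<in>U - {w}. c u \<noteq> 0"
      and eq: "\<forall>d\<in>E. (\<Sum>u\<in>U - {w}. (a d u - a d w * a e u / a e w) * c u) = 0" by auto
    define s where "s = (\<Sum>u\<in>U - {w}. a e u * c u)"
    define c' where "c' = c(w := - s / a e w)"
    have sum: "(\<Sum>u\<in>U. a d u * c' u) = - a d w * s / a e w + (\<Sum>u\<in>U - {w}. a d u * c u)" for d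
    proof -
      have "(\<Sum>u\<in>U. a d u * c' u) = a d w * c' w + (\<Sum>u\<in>U - {w}. a d u * c' u)"
        using insert.prems w by (simp add: sum.remove)
      also have "(\<Sum>u\<in>U - {w}. a d u * c' u) = (\<Sum>u\<in>U - {w}. a d u * c u)"
        by (rule sum.cong) (auto simp: c'_def)
      finally show ?thesis by (simp add: c'_def)
    qed
    have "(\<Sum>u\<in>U. a d u * c' u) = 0" if "d \<in> insert e E" for d
    proof (cases "d = e")
      case True
      then show ?thesis using w sum[of e] by (simp add: s_def)
    next
      case False
      then have "0 = (\<Sum>u\<in>U - {w}. (a d u - a d w * a e u / a e w) * c u)" using that eq by auto
      also have "\<dots> = (\<Sum>u\<in>U - {w}. a d u * c u) - a d w / a e w * s"
        by (simp add: s_def sum_distrib_left algebra_simps sum_subtractf)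
      finally show ?thesis using sum[of d] by simp
    qed
    moreover have "\<exists>u\<in>U. c' u \<noteq> 0" using c by (auto simp: c'_def)
    ultimately show ?thesis by blast
  qed
qed

text \<open>Take a dependency on a set \<open>F\<close> of least cardinality. If weighting its
  coefficients by \<open>z\<close> gave another dependency, subtracting \<open>m\<close> times the
  first would cancel the term of \<open>m\<close> and leave a smaller one. This does the work of
  counting the zeros of a determinant polynomial in the finiteness arguments below.\<close>

lemma infinite_family_relation:
  fixes x :: "'f :: field \<Rightarrow> 'a \<Rightarrow> 'f"
  assumes V: "finite V" and Z: "infinite Z" and nz: "\<forall>z\<in>Z. \<exists>i\<in>V. x z i \<noteq> 0"
  shows "\<exists>F c. finite F \<and> F \<subseteq> Z \<and> (\<forall>i\<in>V. (\<Sum>z\<in>F. c z * x z i) = 0) \<and>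
    (\<exists>i\<in>V. (\<Sum>z\<in>F. c z * z * x z i) \<noteq> 0)"
proof -
  define D where "D F \<longleftrightarrow> finite F \<and> F \<subseteq> Z \<and>
    (\<exists>c. (\<exists>z\<in>F. c z \<noteq> 0) \<and> (\<forall>i\<in>V. (\<Sum>z\<in>F. c z * x z i) = 0))" for F
  obtain F0 where F0: "finite F0" "card F0 = Suc (card V)" "F0 \<subseteq> Z"
    using infinite_arbitrarily_large[OF Z] by blast
  have "\<exists>c. (\<exists>z\<in>F0. c z \<noteq> 0) \<and> (\<forall>i\<in>V. (\<Sum>z\<in>F0. x z i * c z) = 0)"
    by (rule homogeneous_system_nontrivial) (use V F0 in auto)
  then have "D F0" using F0 by (simp add: D_def mult.commute)
  then obtain F where F: "D F" and min: "\<And>G. D G \<Longrightarrow> card F \<le> card G"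
    using ex_has_least_nat[of D F0 card] by blast
  from F obtain c m where fin: "finite F" and FZ: "F \<subseteq> Z" and m: "m \<in> F" "c m \<noteq> 0"
    and rel: "\<And>i. i \<in> V \<Longrightarrow> (\<Sum>z\<in>F. c z * x z i) = 0"
    unfolding D_def by blast
  have "\<exists>i\<in>V. (\<Sum>z\<in>F. c z * z * x z i) \<noteq> 0"
  proof (rule ccontr)
    assume "\<not> ?thesis"
    then have rel2: "(\<Sum>z\<in>F. c z * z * x z i) = 0" if "i \<in> V" for i using that by blast
    have rel3: "(\<Sum>z\<in>F - {m}. c z * (z - m) * x z i) = 0" if "i \<in> V" for i
    proof -
      have "(\<Sum>z\<in>F. c z * (z - m) * x z i) = (\<Sum>z\<in>F. c z * z * x z i) - m * (\<Sum>z\<in>F. c z * x z i)"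
        by (simp add: sum_distrib_left algebra_simps sum_subtractf)
      also have "\<dots> = 0" using rel rel2 that by simp
      finally show ?thesis using fin m by (simp add: sum.remove)
    qed
    show False
    proof (cases "\<exists>z\<in>F - {m}. c z \<noteq> 0")
      case True
      then have "\<exists>z\<in>F - {m}. c z * (z - m) \<noteq> 0" by auto
      then have "D (F - {m})"
        unfolding D_def using fin FZ rel3 by (intro conjI exI[of _ "\<lambda>z. c z * (z - m)"]) auto
      from min[OF this] show False using fin m by (metis card_Diff1_less not_le)
    next
      case False
      then have "(\<Sum>z\<in>F. c z * x z i) = c m * x m i" for i
        using fin m by (simp add: sum.remove)
      then have "\<forall>i\<in>V. x m i = 0" using rel m by simp
      then show False using nz m FZ by blast
    qed
  qed
  then show ?thesis using fin FZ rel by blast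
qed

section \<open>Eigenvector tests and transmission zeros\<close>

definition matvec :: "'a set \<Rightarrow> ('a \<Rightarrow> 'a \<Rightarrow> 'f) \<Rightarrow> ('a \<Rightarrow> 'f) \<Rightarrow> 'a \<Rightarrow> 'f :: comm_ring_1" where
  "matvec V A x i = (\<Sum>j\<in>V. A i j * x j)"

text \<open>The Popov-Belevitch-Hautus test, with right eigenvectors of \<open>A\<close> in place of
  left ones; for the symmetric matrices built later they are the same. The sums with
  \<open>B\<close> are the outputs of \<open>x\<close>.\<close>

definition controllable :: "'a set \<Rightarrow> ('a \<Rightarrow> 'a \<Rightarrow> complex) \<Rightarrow> ('a \<Rightarrow> 'b \<Rightarrow> complex) \<Rightarrow> bool" where
  "controllable V A B \<longleftrightarrow> (\<forall>z x. (\<forall>i\<in>V. matvec V A x i = z * x i) \<longrightarrow>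
     (\<forall>u. (\<Sum>j\<in>V. B j u * x j) = 0) \<longrightarrow> (\<forall>i\<in>V. x i = 0))"

lemma controllableD:
  assumes "controllable V A B" "\<And>i. i \<in> V \<Longrightarrow> matvec V A x i = z * x i"
    "\<And>u. (\<Sum>j\<in>V. B j u * x j) = 0" "i \<in> V"
  shows "x i = 0"
  using assms unfolding controllable_def by blast

lemma controllableI:
  assumes "\<And>z x i. (\<And>i. i \<in> V \<Longrightarrow> matvec V A x i = z * x i) \<Longrightarrow>
    (\<And>u. (\<Sum>j\<in>V. B j u * x j) = 0) \<Longrightarrow> i \<in> V \<Longrightarrow> x i = 0"
  shows "controllable V A B"
  using assms unfolding controllable_def by blast

lemma matvec_cong: "(\<And>j. j \<in> V \<Longrightarrow> x j = y j) \<Longrightarrow> matvec V A x i = matvec V A y i"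
  by (simp add: matvec_def)

lemma matvec_lincomb:
  "matvec V A (\<lambda>j. \<Sum>k\<in>K. c k * x k j) i = (\<Sum>k\<in>K. c k * matvec V A (x k) i)"
  unfolding matvec_def sum_distrib_left
  by (subst sum.swap) (simp add: mult.left_commute)

lemma sum_mult_lincomb:
  fixes c :: "'k \<Rightarrow> 'f :: comm_ring_1"
  shows "(\<Sum>j\<in>V. b j * (\<Sum>k\<in>K. c k * x k j)) = (\<Sum>k\<in>K. c k * (\<Sum>j\<in>V. b j * x k j))"
  unfolding sum_distrib_left
  by (subst sum.swap) (simp add: mult.left_commute)

text \<open>The step from the eigenvector test to Kalman's criterion. If \<open>w\<close> is nonzero
  on \<open>V\<close>, take \<open>p\<close> of least degree with p(A) w = 0 and split off a root
  \<open>r\<close>, p = (X - r) q. Then q(A) w satisfies the eigenvector equation for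
  \<open>r\<close> and has zero outputs, so it vanishes, contradicting minimality.\<close>

lemma controllable_krylov:
  fixes A :: "'a \<Rightarrow> 'a \<Rightarrow> complex"
  assumes V: "finite V" and ctrl: "controllable V A B"
    and B: "\<And>k u. (\<Sum>j\<in>V. B j u * (matvec V A ^^ k) w j) = 0"
    and i: "i \<in> V"
  shows "w i = 0"
proof (rule ccontr)
  assume wi: "w i \<noteq> 0"
  define W where "W k = (matvec V A ^^ k) w" for k
  \<comment> \<open>\<open>ev p\<close> is the vector p(A) w.\<close>
  define ev where "ev p j = (\<Sum>k\<le>degree p. coeff p k * W k j)" for p j
  define D where "D p \<longleftrightarrow> p \<noteq> 0 \<and> (\<forall>j\<in>V. ev p j = 0)" for p
  \<comment> \<open>The \<open>card V + 1\<close> Krylov vectors have only \<open>card V\<close>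
    coordinates on \<open>V\<close>, so they are dependent; the coefficients form the polynomial
    \<open>p0\<close>.\<close>
  have "\<exists>c. (\<exists>k\<in>{..card V}. c k \<noteq> 0) \<and> (\<forall>j\<in>V. (\<Sum>k\<le>card V. W k j * c k) = 0)"
    by (rule homogeneous_system_nontrivial) (use V in auto)
  then obtain c k where c: "k \<le> card V" "c k \<noteq> 0" "\<And>j. j \<in> V \<Longrightarrow> (\<Sum>k\<le>card V. W k j * c k) = 0"
    by auto
  define p0 where "p0 = (\<Sum>k\<le>card V. monom (c k) k)"
  have cf: "coeff p0 k = (if k \<le> card V then c k else 0)" for k
    by (simp add: p0_def coeff_sum)
  have deg: "degree p0 \<le> card V" by (rule degree_le) (simp add: cf)
  have "ev p0 j = 0" if "j \<in> V" for j
  proof -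
    have "ev p0 j = (\<Sum>k\<le>card V. coeff p0 k * W k j)"
      unfolding ev_def by (rule sum.mono_neutral_left) (use deg in \<open>auto intro: coeff_eq_0\<close>)
    then show ?thesis using c(3)[OF that] by (simp add: cf mult.commute)
  qed
  moreover have "p0 \<noteq> 0" using c cf[of k] by auto
  ultimately have "D p0" by (simp add: D_def)
  then obtain p where p: "D p" and min: "\<And>q. D q \<Longrightarrow> degree p \<le> degree q"
    using ex_has_least_nat[of D p0 degree] by blast
  \<comment> \<open>A nonzero constant cannot annihilate \<open>w\<close>, as \<open>w i\<close> is
    nonzero.\<close>
  have "degree p \<noteq> 0"
  proof
    assume "degree p = 0"
    then show False using p i wi unfolding D_def ev_def
      by (auto simp: W_def) (metis leading_coeff_0_iff)
  qed
  then have "\<not> constant (poly p)" by (simp add: constant_degree)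
  then obtain r where "poly p r = 0" using fundamental_theorem_of_algebra by blast
  then obtain q where q: "p = [:- r, 1:] * q" by (auto simp: poly_eq_0_iff_dvd elim: dvdE)
  have q0: "q \<noteq> 0" using q p by (auto simp: D_def)
  have dp: "degree p = Suc (degree q)" using q q0 by (simp add: degree_mult_eq del: mult_pCons_left)
  have cfp: "coeff p k = (case k of 0 \<Rightarrow> 0 | Suc l \<Rightarrow> coeff q l) - r * coeff q k" for k
    by (simp add: q coeff_pCons split: nat.split)
  have evp: "ev p j = matvec V A (ev q) j - r * ev q j" for j
  proof -
    have "ev p j = (\<Sum>k\<le>Suc (degree q). (case k of 0 \<Rightarrow> 0 | Suc l \<Rightarrow> coeff q l) * W k j)
        - r * (\<Sum>k\<le>Suc (degree q). coeff q k * W k j)"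
      by (simp only: ev_def dp cfp sum_distrib_left sum_subtractf left_diff_distrib mult.assoc)
    also have "(\<Sum>k\<le>Suc (degree q). coeff q k * W k j) = ev q j"
      by (simp add: ev_def coeff_eq_0)
    also have "(\<Sum>k\<le>Suc (degree q). (case k of 0 \<Rightarrow> 0 | Suc l \<Rightarrow> coeff q l) * W k j)
      = (\<Sum>k\<le>degree q. coeff q k * W (Suc k) j)"
      by (subst sum.atMost_Suc_shift) simp
    also have "\<dots> = matvec V A (ev q) j"
      unfolding ev_def[abs_def] by (subst matvec_lincomb) (simp add: W_def)
    finally show ?thesis .
  qed
  have "ev q j = 0" if "j \<in> V" for j
  proof (rule controllableD[OF ctrl _ _ that])
    show "matvec V A (ev q) l = r * ev q l" if "l \<in> V" for l
      using evp[of l] p that by (simp add: D_def)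
    show "(\<Sum>j\<in>V. B j u * ev q j) = 0" for u
      unfolding ev_def by (subst sum_mult_lincomb) (simp add: W_def B)
  qed
  then have "D q" using q0 by (simp add: D_def)
  from min[OF this] dp show False by simp
qed

text \<open>Given infinitely many such \<open>z\<close>, apply \<open>A\<close> to a dependency of
  the solutions \<open>X z\<close> with coefficient sum \<open>s\<close>: its
  \<open>z\<close>-weighted sum is nonzero and equals \<open>-s a\<close>. So \<open>s\<close> is
  nonzero, \<open>a\<close> lies in the span of the \<open>X z\<close>, and comparing outputs gives
  \<open>b = 0\<close>. That span is invariant under \<open>A\<close> and has zero outputs, so the
  Krylov criterion yields \<open>a = 0\<close>.\<close>

lemma finite_transmission_zeros:
  fixes A :: "'a \<Rightarrow> 'a \<Rightarrow> complex"
  assumes V: "finite V" and ctrl: "controllable V A B"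
    and nz: "(\<exists>i\<in>V. a i \<noteq> 0) \<or> (\<exists>u. b u \<noteq> 0)"
  shows "finite {z. \<exists>x. (\<forall>i\<in>V. matvec V A x i = z * x i + a i) \<and> (\<forall>u. (\<Sum>j\<in>V. B j u * x j) = b u)}"
    (is "finite ?Z")
proof (rule ccontr)
  define Z where "Z = ?Z"
  assume "infinite ?Z"
  then have inf: "infinite Z" by (simp add: Z_def)
  define X where "X z = (SOME x. (\<forall>i\<in>V. matvec V A x i = z * x i + a i) \<and>
    (\<forall>u. (\<Sum>j\<in>V. B j u * x j) = b u))" for z
  have X: "(\<forall>i\<in>V. matvec V A (X z) i = z * X z i + a i) \<and> (\<forall>u. (\<Sum>j\<in>V. B j u * X z j) = b u)"
    if "z \<in> Z" for z
    using that unfolding X_def Z_def mem_Collect_eq by (rule someI_ex)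
  \<comment> \<open>A vanishing solution would force both \<open>a\<close> and \<open>b\<close> to
    vanish.\<close>
  have Xnz: "\<forall>z\<in>Z. \<exists>i\<in>V. X z i \<noteq> 0"
  proof (intro ballI, rule ccontr)
    fix z assume "z \<in> Z" and 00: "\<not> (\<exists>i\<in>V. X z i \<noteq> 0)"
    from 00 have 0: "\<And>i. i \<in> V \<Longrightarrow> X z i = 0" by blast
    have "a i = 0" if "i \<in> V" for i
      using X[OF \<open>z \<in> Z\<close>] that 0 by (simp add: matvec_def)
    moreover have "b u = 0" for u
      using X[OF \<open>z \<in> Z\<close>, THEN conjunct2, rule_format, of u] 0 by simp
    ultimately show False using nz by blast
  qed
  from infinite_family_relation[OF V inf Xnz]
  obtain F c where F: "finite F" "F \<subseteq> Z"
    and rel: "\<forall>i\<in>V. (\<Sum>z\<in>F. c z * X z i) = 0"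
    and nrel: "\<exists>i\<in>V. (\<Sum>z\<in>F. c z * z * X z i) \<noteq> 0" by blast
  have XV: "matvec V A (X z) i = z * X z i + a i" if "z \<in> F" "i \<in> V" for z i
    using X[of z] F that by blast
  have XB: "(\<Sum>j\<in>V. B j u * X z j) = b u" if "z \<in> F" for z u
    using X[of z] F that by blast
  define s where "s = (\<Sum>z\<in>F. c z)"
  have app: "matvec V A (\<lambda>j. \<Sum>z\<in>F. e z * X z j) i = (\<Sum>z\<in>F. e z * z * X z i) + (\<Sum>z\<in>F. e z) * a i"
    if "i \<in> V" for e i
  proof -
    have "matvec V A (\<lambda>j. \<Sum>z\<in>F. e z * X z j) i = (\<Sum>z\<in>F. e z * (z * X z i + a i))"
      unfolding matvec_lincomb by (rule sum.cong) (simp_all add: XV that)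
    then show ?thesis by (simp add: sum_distrib_right distrib_left sum.distrib mult.assoc)
  qed
  have outp: "(\<Sum>j\<in>V. B j u * (\<Sum>z\<in>F. e z * X z j)) = (\<Sum>z\<in>F. e z) * b u" for e u
  proof -
    have "(\<Sum>j\<in>V. B j u * (\<Sum>z\<in>F. e z * X z j)) = (\<Sum>z\<in>F. e z * b u)"
      by (subst sum_mult_lincomb) (rule sum.cong, simp_all add: XB)
    then show ?thesis by (simp add: sum_distrib_right)
  qed
  have rel2: "(\<Sum>z\<in>F. c z * z * X z i) = - s * a i" if "i \<in> V" for i
  proof -
    have "matvec V A (\<lambda>j. \<Sum>z\<in>F. c z * X z j) i = 0"
      using rel by (simp add: matvec_def)
    then show ?thesis using app[OF that, of c] by (simp add: s_def eq_neg_iff_add_eq_0)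
  qed
  then have s: "s \<noteq> 0" using nrel by auto
  have b: "b u = 0" for u
    using outp[of u c] rel s by (simp add: s_def)
  define d where "d z = - c z * z / s" for z
  have a: "a i = (\<Sum>z\<in>F. d z * X z i)" if "i \<in> V" for i
  proof -
    have "(\<Sum>z\<in>F. d z * X z i) = - (\<Sum>z\<in>F. c z * z * X z i) / s"
      by (simp add: d_def sum_divide_distrib sum_negf)
    then show ?thesis using rel2[OF that] s by simp
  qed
  \<comment> \<open>The span is invariant because \<open>A\<close> maps \<open>X z\<close> to
    \<open>z X z + a\<close>, and \<open>a\<close> is in the span by \<open>d\<close>.\<close>
  have span: "\<exists>e. \<forall>i\<in>V. (matvec V A ^^ k) a i = (\<Sum>z\<in>F. e z * X z i)" for k
  proof (induction k)
    case 0
    then show ?case using a by auto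
  next
    case (Suc k)
    then obtain e where e: "\<forall>i\<in>V. (matvec V A ^^ k) a i = (\<Sum>z\<in>F. e z * X z i)" by blast
    have "(matvec V A ^^ Suc k) a i = (\<Sum>z\<in>F. (e z * z + (\<Sum>z\<in>F. e z) * d z) * X z i)" if "i \<in> V" for i
    proof -
      have "(matvec V A ^^ Suc k) a i = matvec V A (\<lambda>j. \<Sum>z\<in>F. e z * X z j) i"
        using e by (auto intro: matvec_cong)
      also have "\<dots> = (\<Sum>z\<in>F. e z * z * X z i) + (\<Sum>z\<in>F. e z) * (\<Sum>z\<in>F. d z * X z i)"
        using app[OF that, of e] a[OF that] by simp
      finally show ?thesis by (simp add: distrib_right sum.distrib sum_distrib_left mult.assoc)
    qed
    then show ?case by (intro exI[of _ "\<lambda>z. e z * z + (\<Sum>z\<in>F. e z) * d z"]) blast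
  qed
  have "a i = 0" if "i \<in> V" for i
  proof (rule controllable_krylov[OF V ctrl _ that])
    show "(\<Sum>j\<in>V. B j u * (matvec V A ^^ k) a j) = 0" for k u
    proof -
      obtain e where "\<forall>i\<in>V. (matvec V A ^^ k) a i = (\<Sum>z\<in>F. e z * X z i)" using span by blast
      then show ?thesis using outp[of u e] b by simp
    qed
  qed
  then show False using nz b by blast
qed

subsection \<open>Attaching a scaled block\<close>

definition nonsingular_on :: "'a set \<Rightarrow> ('a \<Rightarrow> 'a \<Rightarrow> complex) \<Rightarrow> bool" where
  "nonsingular_on C M \<longleftrightarrow> (\<forall>y. (\<forall>i\<in>C. matvec C M y i = 0) \<longrightarrow> (\<forall>i\<in>C. y i = 0))"

text \<open>For kernel vectors \<open>Y s\<close> of infinitely many \<open>s\<close>, a dependency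
  gives \<open>M (\<Sum> c s Y) = N (\<Sum> c Y) = 0\<close>. Nonsingularity of \<open>M\<close>
  then kills the \<open>s\<close>-weighted sum, which was chosen nonzero.\<close>

lemma finite_singular_pencil:
  assumes C: "finite C" and M: "nonsingular_on C M"
  shows "finite {s. \<exists>y. (\<exists>i\<in>C. y i \<noteq> 0) \<and> (\<forall>i\<in>C. s * matvec C M y i = matvec C N y i)}"
    (is "finite ?Z")
proof (rule ccontr)
  define Z where "Z = ?Z"
  assume "infinite ?Z"
  then have inf: "infinite Z" by (simp add: Z_def)
  define Y where "Y s = (SOME y. (\<exists>i\<in>C. y i \<noteq> 0) \<and> (\<forall>i\<in>C. s * matvec C M y i = matvec C N y i))" for s
  have Y: "(\<exists>i\<in>C. Y s i \<noteq> 0) \<and> (\<forall>i\<in>C. s * matvec C M (Y s) i = matvec C N (Y s) i)" if "s \<in> Z" for s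
    using that unfolding Y_def Z_def mem_Collect_eq by (rule someI_ex)
  then have Ynz: "\<forall>s\<in>Z. \<exists>i\<in>C. Y s i \<noteq> 0" by blast
  from infinite_family_relation[OF C inf Ynz]
  obtain F c where F: "finite F" "F \<subseteq> Z"
    and rel: "\<forall>i\<in>C. (\<Sum>s\<in>F. c s * Y s i) = 0"
    and nrel: "\<exists>i\<in>C. (\<Sum>s\<in>F. c s * s * Y s i) \<noteq> 0" by blast
  have "matvec C M (\<lambda>j. \<Sum>s\<in>F. c s * s * Y s j) i = 0" if "i \<in> C" for i
  proof -
    have "matvec C M (\<lambda>j. \<Sum>s\<in>F. c s * s * Y s j) i = (\<Sum>s\<in>F. c s * matvec C N (Y s) i)"
      unfolding matvec_lincomb by (rule sum.cong) (use Y F that in \<open>auto simp: mult.assoc\<close>)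
    also have "\<dots> = matvec C N (\<lambda>j. \<Sum>s\<in>F. c s * Y s j) i"
      by (simp add: matvec_lincomb)
    also have "\<dots> = 0" using rel by (simp add: matvec_def)
    finally show ?thesis .
  qed
  then show False using M nrel unfolding nonsingular_on_def by blast
qed

text \<open>The eigenvector test with the coordinate at \<open>c\<close> as the only output.\<close>

definition rooted_controllable :: "'a set \<Rightarrow> ('a \<Rightarrow> 'a \<Rightarrow> complex) \<Rightarrow> 'a \<Rightarrow> bool" where
  "rooted_controllable C M c \<longleftrightarrow> (\<forall>z y. (\<forall>i\<in>C. matvec C M y i = z * y i) \<longrightarrow> y c = 0 \<longrightarrow> (\<forall>i\<in>C. y i = 0))"

text \<open>The blocks interact only through row and column \<open>c\<close>; both carry the same
  vector \<open>a\<close>, so that the joined matrix is symmetric when \<open>A\<close> and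
  \<open>M\<close> are.\<close>

definition join_states :: "'a set \<Rightarrow> 'a set \<Rightarrow> 'a \<Rightarrow> ('a \<Rightarrow> 'f) \<Rightarrow> ('a \<Rightarrow> 'a \<Rightarrow> 'f) \<Rightarrow> ('a \<Rightarrow> 'a \<Rightarrow> 'f) \<Rightarrow> 'a \<Rightarrow> 'a \<Rightarrow> 'f :: zero" where
  "join_states V C c a A M i j =
    (if i \<in> V \<and> j \<in> V then A i j else if i \<in> V \<and> j = c then a i else if i = c \<and> j \<in> V then a j
     else if i \<in> C \<and> j \<in> C then M i j else 0)"

definition join_inputs :: "'a set \<Rightarrow> 'a \<Rightarrow> ('b \<Rightarrow> 'f) \<Rightarrow> ('a \<Rightarrow> 'b \<Rightarrow> 'f) \<Rightarrow> 'a \<Rightarrow> 'b \<Rightarrow> 'f :: zero" where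
  "join_inputs V c b B i u = (if i \<in> V then B i u else if i = c then b u else 0)"

text \<open>Let \<open>x\<close> be an eigenvector without output. If \<open>x c = 0\<close>, its
  \<open>V\<close>-part satisfies the old test and vanishes, and then the rooted test on
  \<open>C\<close> applies. If \<open>x c\<close> is nonzero, the rescaled \<open>V\<close>-part
  solves the system with right side \<open>a\<close>, \<open>b\<close>, so \<open>z\<close> is one
  of finitely many zeros. Substituting it into row \<open>c\<close> leaves a pencil on
  \<open>C\<close> that is singular for finitely many \<open>s\<close>.\<close>

lemma controllable_join:
  fixes A :: "'a \<Rightarrow> 'a \<Rightarrow> complex"
  assumes V: "finite V" and C: "finite C" and disj: "V \<inter> C = {}" and c: "c \<in> C"
    and ctrl: "controllable V A B" and M: "nonsingular_on C M" "rooted_controllable C M c"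
    and nz: "(\<exists>i\<in>V. a i \<noteq> 0) \<or> (\<exists>u. b u \<noteq> 0)"
  shows "finite {s. \<not> controllable (V \<union> C) (join_states V C c a A (\<lambda>i j. s * M i j)) (join_inputs V c b B)}"
    (is "finite ?S")
proof -
  define ok where "ok z x \<longleftrightarrow>
    (\<forall>i\<in>V. matvec V A x i = z * x i + a i) \<and> (\<forall>u. (\<Sum>j\<in>V. B j u * x j) = b u)" for z x
  define Z where "Z = {z. \<exists>x. ok z x}"
  have Z: "finite Z" unfolding Z_def ok_def by (rule finite_transmission_zeros[OF V ctrl nz])
  \<comment> \<open>The difference of two solutions is an eigenvector without output. Hence the
    pencil for \<open>z\<close> depends on \<open>z\<close> alone and not on the given
    eigenvector.\<close>
  have unique: "x i = x' i" if "ok z x" "ok z x'" "i \<in> V" for z x x' i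
  proof -
    have "x i - x' i = 0"
    proof (rule controllableD[OF ctrl _ _ \<open>i \<in> V\<close>])
      show "matvec V A (\<lambda>i. x i - x' i) k = z * (x k - x' k)" if "k \<in> V" for k
      proof -
        have "matvec V A (\<lambda>i. x i - x' i) k = matvec V A x k - matvec V A x' k"
          by (simp add: matvec_def right_diff_distrib sum_subtractf)
        then show ?thesis using \<open>ok z x\<close> \<open>ok z x'\<close> that by (simp add: ok_def algebra_simps)
      qed
      show "(\<Sum>j\<in>V. B j u * (x j - x' j)) = 0" for u
        using that by (simp add: ok_def right_diff_distrib sum_subtractf)
    qed
    then show ?thesis by simp
  qed
  define X where "X z = (SOME x. ok z x)" for z
  have X: "ok z (X z)" if "z \<in> Z" for z
    using that unfolding X_def Z_def mem_Collect_eq by (rule someI_ex)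
  \<comment> \<open>The diagonal matrix \<open>z I\<close>, corrected at \<open>c\<close> by the
    feedback through \<open>V\<close>: the chosen solution \<open>X z\<close> paired with the link
    vector \<open>a\<close>.\<close>
  define N where "N z i j = (if i = j then z + (if i = c then \<Sum>k\<in>V. a k * X z k else 0) else 0)" for z i j
  have N: "matvec C (N z) y i = z * y i + (if i = c then (\<Sum>k\<in>V. a k * X z k) * y c else 0)"
    if "i \<in> C" for z y i
  proof -
    have "matvec C (N z) y i = (\<Sum>j\<in>C. if j = i then N z i i * y i else 0)"
      unfolding matvec_def by (rule sum.cong) (auto simp: N_def)
    then show ?thesis using C that by (simp add: N_def algebra_simps)
  qed
  define E where "E z = {s. \<exists>y. (\<exists>i\<in>C. y i \<noteq> 0) \<and> (\<forall>i\<in>C. s * matvec C M y i = matvec C (N z) y i)}" for z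
  have E: "finite (E z)" for z unfolding E_def by (rule finite_singular_pencil[OF C M(1)])
  have "s \<in> insert 0 (\<Union>z\<in>Z. E z)" if "s \<in> ?S" for s
  proof (rule ccontr)
    assume contra: "s \<notin> insert 0 (\<Union>z\<in>Z. E z)"
    let ?A = "join_states V C c a A (\<lambda>i j. s * M i j)" and ?B = "join_inputs V c b B"
    have "controllable (V \<union> C) ?A ?B"
    proof (rule controllableI)
      fix z x i
      assume eig: "\<And>i. i \<in> V \<union> C \<Longrightarrow> matvec (V \<union> C) ?A x i = z * x i"
        and outp: "\<And>u. (\<Sum>j\<in>V \<union> C. ?B j u * x j) = 0" and i: "i \<in> V \<union> C"
      have split: "(\<Sum>j\<in>V \<union> C. g j) = (\<Sum>j\<in>V. g j) + (\<Sum>j\<in>C. g j)" for g :: "'a \<Rightarrow> complex"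
        by (rule sum.union_disjoint[OF V C disj])
      have eqV: "matvec V A x k = z * x k - x c * a k" if "k \<in> V" for k
      proof -
        have "(\<Sum>j\<in>V. ?A k j * x j) = matvec V A x k"
          unfolding matvec_def by (rule sum.cong) (use that in \<open>auto simp: join_states_def\<close>)
        moreover have "(\<Sum>j\<in>C. ?A k j * x j) = (\<Sum>j\<in>C. if j = c then a k * x c else 0)"
          by (rule sum.cong) (use that disj in \<open>auto simp: join_states_def\<close>)
        ultimately show ?thesis using eig[of k] that C c
          by (simp add: matvec_def split algebra_simps)
      qed
      have eqC: "s * matvec C M x k = z * x k - (if k = c then (\<Sum>j\<in>V. a j * x j) else 0)" if "k \<in> C" for k
      proof -
        have "(\<Sum>j\<in>V. ?A k j * x j) = (if k = c then (\<Sum>j\<in>V. a j * x j) else 0)"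
          using that disj by (auto simp: join_states_def intro!: sum.cong sum.neutral)
        moreover have "(\<Sum>j\<in>C. ?A k j * x j) = s * matvec C M x k"
          unfolding matvec_def sum_distrib_left
          by (rule sum.cong) (use that disj c in \<open>auto simp: join_states_def mult.assoc\<close>)
        ultimately show ?thesis using eig[of k] that by (simp add: matvec_def split algebra_simps)
      qed
      have eqB: "(\<Sum>j\<in>V. B j u * x j) = - x c * b u" for u
      proof -
        have "(\<Sum>j\<in>V. ?B j u * x j) = (\<Sum>j\<in>V. B j u * x j)"
          by (rule sum.cong) (auto simp: join_inputs_def)
        moreover have "(\<Sum>j\<in>C. ?B j u * x j) = (\<Sum>j\<in>C. if j = c then b u * x c else 0)"
          by (rule sum.cong) (use disj in \<open>auto simp: join_inputs_def\<close>)
        ultimately show ?thesis using outp[of u] C c by (simp add: split add_eq_0_iff mult.commute)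
      qed
      have xc: "x c = 0"
      proof (rule ccontr)
        assume xc: "x c \<noteq> 0"
        \<comment> \<open>The sign and scale turn the contribution of \<open>c\<close> into exactly
          \<open>a\<close> and \<open>b\<close>.\<close>
        define x' where "x' k = - x k / x c" for k
        have x: "x k = - x c * x' k" for k using xc by (simp add: x'_def)
        have "ok z x'"
          unfolding ok_def
        proof (intro conjI ballI allI)
          show "matvec V A x' k = z * x' k + a k" if "k \<in> V" for k
          proof -
            have "matvec V A x' k = - matvec V A x k / x c"
              by (simp add: matvec_def x'_def sum_negf sum_divide_distrib)
            then show ?thesis using eqV[OF that] xc by (simp add: x'_def field_simps)
          qed
          show "(\<Sum>j\<in>V. B j u * x' j) = b u" for u
          proof -
            have "(\<Sum>j\<in>V. B j u * x' j) = - (\<Sum>j\<in>V. B j u * x j) / x c"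
              by (simp add: x'_def sum_negf sum_divide_distrib)
            then show ?thesis using eqB[of u] xc by simp
          qed
        qed
        then have z: "z \<in> Z" by (auto simp: Z_def)
        have "x k = - x c * X z k" if "k \<in> V" for k
          using x[of k] unique[OF \<open>ok z x'\<close> X[OF z] that] by simp
        then have "(\<Sum>j\<in>V. a j * x j) = (\<Sum>j\<in>V. a j * (- x c * X z j))"
          by (intro sum.cong) (metis (no_types))+
        also have "\<dots> = - x c * (\<Sum>j\<in>V. a j * X z j)"
          by (simp add: sum_distrib_left sum_negf algebra_simps)
        finally have "s * matvec C M x k = matvec C (N z) x k" if "k \<in> C" for k
          using eqC[OF that] N[OF that] by simp
        then have "s \<in> E z" unfolding E_def using c xc by blast
        then show False using contra z by blast
      qed
      have xV: "x k = 0" if "k \<in> V" for k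
        by (rule controllableD[OF ctrl _ _ that, where z = z]) (use eqV eqB xc in auto)
      \<comment> \<open>For nonzero \<open>s\<close>, scaling the block only rescales its
        eigenvalue, so the rooted test of the unscaled \<open>M\<close> applies; this is why 0 is
        among the excluded values.\<close>
      have "matvec C M x k = (z / s) * x k" if "k \<in> C" for k
        using eqC[OF that] contra by (auto simp: xV field_simps split: if_splits)
      then have "\<forall>k\<in>C. x k = 0" using M(2) xc unfolding rooted_controllable_def by blast
      then show "x i = 0" using i xV by blast
    qed
    then show False using that by simp
  qed
  then have "?S \<subseteq> insert 0 (\<Union>z\<in>Z. E z)" by blast
  then show ?thesis by (rule finite_subset) (use Z E in auto)
qed

subsection \<open>Weighted cycles\<close>

text \<open>The closing edge has weight 2: with weight 1 everywhere, eigenvectors antisymmetric about the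
  vertex \<open>0\<close> vanish there, and cycles of length divisible by 4 are singular.\<close>

definition cycle_matrix :: "nat \<Rightarrow> nat \<Rightarrow> nat \<Rightarrow> complex" where
  "cycle_matrix L i j =
    (if i = 0 \<and> j = L - 1 \<or> i = L - 1 \<and> j = 0 then 2 else if i = Suc j \<or> j = Suc i then 1 else 0)"

text \<open>From length 3 on, the two cyclic neighbours of a vertex are distinct, so each row has
  two entries. Lengths 1 and 2, a self-loop and a single undirected edge, are treated
  separately.\<close>

lemma cycle_matrix_row:
  assumes "3 \<le> L" "i < L"
  shows "matvec {..<L} (cycle_matrix L) y i =
    (if i = 0 then y 1 + 2 * y (L - 1) else if i = L - 1 then y (L - 2) + 2 * y 0 else y (i - 1) + y (Suc i))"
proof -
  let ?p = "if i = 0 then L - 1 else i - 1" and ?q = "if i = L - 1 then 0 else Suc i"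
  have "matvec {..<L} (cycle_matrix L) y i = (\<Sum>j\<in>{?p, ?q}. cycle_matrix L i j * y j)"
    unfolding matvec_def
    by (rule sum.mono_neutral_right) (use assms in \<open>auto simp: cycle_matrix_def\<close>)
  also have "\<dots> = cycle_matrix L i ?p * y ?p + cycle_matrix L i ?q * y ?q"
    by (subst sum.insert) (use assms in auto)
  finally have row: "matvec {..<L} (cycle_matrix L) y i
    = cycle_matrix L i ?p * y ?p + cycle_matrix L i ?q * y ?q" .
  obtain m where m: "L = Suc (Suc (Suc m))"
    using that[of "L - 3"] assms(1) by simp
  show ?thesis
  proof (cases "i = 0 \<or> i = Suc (Suc m)")
    case True
    then show ?thesis unfolding row unfolding m by (auto simp: cycle_matrix_def)
  next
    case False
    then obtain k where "i = Suc k" by (cases i) auto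
    then show ?thesis unfolding row unfolding m using False by (auto simp: cycle_matrix_def)
  qed
qed

lemma cycle_matrix_row_small:
  "matvec {..<1} (cycle_matrix 1) y 0 = 2 * y 0"
  "matvec {..<2} (cycle_matrix 2) y 0 = 2 * y 1"
  "matvec {..<2} (cycle_matrix 2) y 1 = 2 * y 0"
proof -
  have "{..<1} = {0 :: nat}" "{..<2} = {0, 1 :: nat}" by auto
  then show "matvec {..<1} (cycle_matrix 1) y 0 = 2 * y 0"
    "matvec {..<2} (cycle_matrix 2) y 0 = 2 * y 1" "matvec {..<2} (cycle_matrix 2) y 1 = 2 * y 0"
    by (simp_all add: matvec_def cycle_matrix_def)
qed

lemma less_small_cases: "0 < (L :: nat) \<Longrightarrow> L = 1 \<or> L = 2 \<or> 3 \<le> L"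
  by presburger

text \<open>The inner rows read \<open>y (k + 2) = - y k\<close>, so a kernel vector is determined
  by \<open>y 0\<close> and \<open>y 1\<close>; the two rows at the closing edge force both to
  vanish.\<close>

lemma nonsingular_cycle_matrix:
  assumes L: "0 < L"
  shows "nonsingular_on {..<L} (cycle_matrix L)"
  unfolding nonsingular_on_def
proof (intro allI impI)
  fix y assume y: "\<forall>i\<in>{..<L}. matvec {..<L} (cycle_matrix L) y i = 0"
  consider "L = 1" | "L = 2" | "3 \<le> L" using less_small_cases[OF L] by blast
  then show "\<forall>i\<in>{..<L}. y i = 0"
  proof cases
    case 1
    then show ?thesis using y cycle_matrix_row_small(1)[of y] by auto
  next
    case 2
    then show ?thesis
      using y cycle_matrix_row_small(2,3)[of y] by (auto simp: less_2_cases_iff)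
  next
    case 3
    have first: "y 1 + 2 * y (L - 1) = 0"
      using y[rule_format, of 0] cycle_matrix_row[OF 3, of 0 y] 3 by simp
    have final: "y (L - 2) + 2 * y 0 = 0"
      using y[rule_format, of "L - 1"] cycle_matrix_row[OF 3, of "L - 1" y] 3 by simp
    have step: "y (Suc (Suc k)) = - y k" if "Suc (Suc k) < L" for k
      using y[rule_format, of "Suc k"] cycle_matrix_row[OF 3, of "Suc k" y] that
      by (auto simp: eq_neg_iff_add_eq_0 add.commute split: if_splits)
    have ev: "2 * k < L \<Longrightarrow> y (2 * k) = (-1) ^ k * y 0" for k
      by (induction k) (use step in auto)
    have od: "Suc (2 * k) < L \<Longrightarrow> y (Suc (2 * k)) = (-1) ^ k * y 1" for k
      by (induction k) (use step in auto)
    have sgn: "(-1 :: complex) ^ k = 1 \<or> (-1 :: complex) ^ k = -1" for k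
      by (induction k) auto
    \<comment> \<open>For even \<open>L\<close> each closing row involves only one of the two
      values, with coefficient \<plusminus>1 or 3. For odd \<open>L\<close> the rows form a 2 by 2
      system.\<close>
    have "y 0 = 0 \<and> y 1 = 0"
    proof (cases "even L")
      case True
      then obtain k where "L = 2 * k" by blast
      with 3 obtain m where m: "L = 2 * Suc m" by (cases k) auto
      have "y (L - 2) = (-1) ^ m * y 0" "y (L - 1) = (-1) ^ m * y 1"
        using ev[of m] od[of m] m by auto
      then show ?thesis using first final sgn[of m] by auto
    next
      case False
      then obtain k where "L = Suc (2 * k)" by (auto elim: oddE)
      with 3 obtain m where m: "L = Suc (2 * Suc m)" by (cases k) auto
      define s :: complex where "s = (-1) ^ m"
      have val: "y (L - 2) = s * y 1" "y (L - 1) = - (s * y 0)"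
        using ev[of "Suc m"] od[of m] m by (auto simp: s_def)
      have s: "s * (s * t) = t" for t
        using sgn[of m] by (auto simp: s_def)
      \<comment> \<open>Row \<open>final\<close> minus \<open>s\<close> times row
        \<open>first\<close> eliminates \<open>y 1\<close>, because
        \<open>s * s = 1\<close>.\<close>
      have "4 * y 0 = (y (L - 2) + 2 * y 0) - s * (y 1 + 2 * y (L - 1))"
        unfolding val by (simp add: algebra_simps s)
      then have "y 0 = 0" using first final by simp
      then show ?thesis using first val by simp
    qed
    then have "y i = 0" if "i < L" for i
      using ev[of "i div 2"] od[of "i div 2"] that by (cases "even i") simp_all
    then show ?thesis by blast
  qed
qed

text \<open>Since \<open>y 0 = 0\<close>, the last row continues the recursion with next value 0,
  which makes \<open>y (L - 1)\<close> and \<open>y 1\<close> equal up to sign. Row 0 says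
  \<open>y 1 = - 2 * y (L - 1)\<close>, so both are 0, and the recursion propagates the
  zeros.\<close>

lemma rooted_controllable_cycle_matrix:
  assumes L: "0 < L"
  shows "rooted_controllable {..<L} (cycle_matrix L) 0"
  unfolding rooted_controllable_def
proof (intro allI impI)
  fix z y assume y: "\<forall>i\<in>{..<L}. matvec {..<L} (cycle_matrix L) y i = z * y i" and y0: "y 0 = 0"
  consider "L = 1" | "L = 2" | "3 \<le> L" using less_small_cases[OF L] by blast
  then show "\<forall>i\<in>{..<L}. y i = 0"
  proof cases
    case 1
    then show ?thesis using y0 by auto
  next
    case 2
    then show ?thesis
      using y y0 cycle_matrix_row_small(2)[of y] by (auto simp: less_2_cases_iff)
  next
    case 3
    have first: "y 1 + 2 * y (L - 1) = 0"
      using y[rule_format, of 0] cycle_matrix_row[OF 3, of 0 y] 3 y0 by simp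
    have final: "y (L - 2) = z * y (L - 1)"
      using y[rule_format, of "L - 1"] cycle_matrix_row[OF 3, of "L - 1" y] 3 y0 by simp
    have step: "y (Suc (Suc k)) = z * y (Suc k) - y k" if "Suc (Suc k) < L" for k
      using y[rule_format, of "Suc k"] cycle_matrix_row[OF 3, of "Suc k" y] that
      by (auto simp: eq_diff_eq add.commute split: if_splits)
    \<comment> \<open>The quadratic form below is an invariant of the recursion, so that \<open>y (L - 1) = \<plusminus> y 1\<close>.\<close>
    have inv: "Suc k < L \<Longrightarrow> y (Suc k) ^ 2 + y k ^ 2 - z * y k * y (Suc k) = y 1 ^ 2" for k
    proof (induction k)
      case 0
      then show ?case using y0 by simp
    next
      case (Suc k)
      have "y (Suc (Suc k)) ^ 2 + y (Suc k) ^ 2 - z * y (Suc k) * y (Suc (Suc k))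
        = y (Suc k) ^ 2 + y k ^ 2 - z * y k * y (Suc k)"
        unfolding step[OF Suc.prems] by (simp add: power2_eq_square algebra_simps)
      then show ?case using Suc by simp
    qed
    obtain m where m: "L = Suc (Suc m)" using that[of "L - 2"] 3 by simp
    have fm: "y m = z * y (Suc m)" using final unfolding m by simp
    have "y (L - 1) ^ 2 = y (Suc m) ^ 2 + y m ^ 2 - z * y m * y (Suc m)"
      unfolding fm using m by (simp add: power2_eq_square algebra_simps)
    then have "y (L - 1) ^ 2 = y 1 ^ 2" using inv[of m] m by simp
    then have "y (L - 1) = y 1 \<or> y (L - 1) = - y 1" by (simp add: power2_eq_iff)
    then have y1: "y 1 = 0" using first by auto
    have zero: "Suc k < L \<Longrightarrow> y (Suc k) = 0 \<and> y k = 0" for k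
    proof (induction k)
      case 0
      then show ?case using y0 y1 by simp
    next
      case (Suc k)
      then show ?case using step[of k] by auto
    qed
    have "y i = 0" if "i < L" for i
      using that y0 zero[of "i - 1"] by (cases i) auto
    then show ?thesis by blast
  qed
qed

section \<open>Transport of a matrix along an enumeration of its vertices\<close>

lemma matvec_inv_into:
  assumes p: "inj_on p {..<L}" and k: "k < L"
  shows "matvec (p ` {..<L}) (\<lambda>i j. M (inv_into {..<L} p i) (inv_into {..<L} p j)) y (p k)
    = matvec {..<L} M (y \<circ> p) k"
  unfolding matvec_def
  by (subst sum.reindex[OF p]) (use p k in \<open>auto intro!: sum.cong simp: inv_into_f_f\<close>)

lemma nonsingular_on_inv_into:
  assumes p: "inj_on p {..<L}" and "nonsingular_on {..<L} M"
  shows "nonsingular_on (p ` {..<L}) (\<lambda>i j. M (inv_into {..<L} p i) (inv_into {..<L} p j))"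
  unfolding nonsingular_on_def
proof (intro allI impI)
  fix y assume "\<forall>i\<in>p ` {..<L}. matvec (p ` {..<L}) (\<lambda>i j. M (inv_into {..<L} p i) (inv_into {..<L} p j)) y i = 0"
  then have "\<forall>k\<in>{..<L}. matvec {..<L} M (y \<circ> p) k = 0"
    using matvec_inv_into[OF p, of _ M y] by simp
  then have "\<forall>k\<in>{..<L}. (y \<circ> p) k = 0" using assms(2) unfolding nonsingular_on_def by blast
  then show "\<forall>i\<in>p ` {..<L}. y i = 0" by simp
qed

lemma rooted_controllable_inv_into:
  assumes p: "inj_on p {..<L}" and "rooted_controllable {..<L} M r"
  shows "rooted_controllable (p ` {..<L}) (\<lambda>i j. M (inv_into {..<L} p i) (inv_into {..<L} p j)) (p r)"
  unfolding rooted_controllable_def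
proof (intro allI impI)
  fix z y assume "\<forall>i\<in>p ` {..<L}.
      matvec (p ` {..<L}) (\<lambda>i j. M (inv_into {..<L} p i) (inv_into {..<L} p j)) y i = z * y i"
    and "y (p r) = 0"
  then have "\<forall>k\<in>{..<L}. matvec {..<L} M (y \<circ> p) k = z * (y \<circ> p) k" "(y \<circ> p) r = 0"
    using matvec_inv_into[OF p, of _ M y] by simp_all
  then have "\<forall>k\<in>{..<L}. (y \<circ> p) k = 0" using assms(2) unfolding rooted_controllable_def by blast
  then show "\<forall>i\<in>p ` {..<L}. y i = 0" by simp
qed

subsection \<open>Hall's theorem and symmetric real matrices\<close>

text \<open>Induction on \<open>card R\<close>. If a proper nonempty \<open>T\<close> has exactly
  \<open>card T\<close> neighbours, \<open>T\<close> and \<open>R - T\<close> are matched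
  separately; equality for \<open>T\<close> keeps the condition for the rest after the neighbours of
  \<open>T\<close> are removed. Otherwise every proper nonempty subset has a spare neighbour, so any
  one element may be matched at will.\<close>

lemma hall_marriage:
  fixes N :: "'a \<Rightarrow> 'b set"
  assumes "finite R" "\<And>i. i \<in> R \<Longrightarrow> finite (N i)"
    "\<And>S. S \<subseteq> R \<Longrightarrow> card S \<le> card (\<Union>i\<in>S. N i)"
  shows "\<exists>f. inj_on f R \<and> (\<forall>i\<in>R. f i \<in> N i)"
  using assms
proof (induction "card R" arbitrary: R N rule: less_induct)
  case less
  note fin = less.prems(1,2) and hall = less.prems(3)
  consider "R = {}" | (tight) T where "T \<subset> R" "T \<noteq> {}" "card (\<Union>i\<in>T. N i) = card T"
    | (slack) "R \<noteq> {}" "\<And>T. T \<subset> R \<Longrightarrow> T \<noteq> {} \<Longrightarrow> card T < card (\<Union>i\<in>T. N i)"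
    using hall by (metis le_neq_implies_less psubset_imp_subset)
  then show ?case
  proof cases
    case 1
    then show ?thesis by simp
  next
    case tight
    let ?U = "\<Union>i\<in>T. N i"
    have finT: "finite T" using tight(1) fin(1) by (auto intro: finite_subset)
    have finU: "finite ?U" using finT tight(1) fin(2) by blast
    have "\<exists>f. inj_on f T \<and> (\<forall>i\<in>T. f i \<in> N i)"
    proof (rule less.hyps)
      show "card T < card R" using tight fin by (simp add: psubset_card_mono)
    qed (use tight fin hall finT in auto)
    then obtain f where f: "inj_on f T" "\<forall>i\<in>T. f i \<in> N i" by blast
    have "\<exists>g. inj_on g (R - T) \<and> (\<forall>i\<in>R - T. g i \<in> N i - ?U)"
    proof (rule less.hyps)
      show "card (R - T) < card R"
        using tight fin by (intro psubset_card_mono) auto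
      show "card S \<le> card (\<Union>i\<in>S. N i - ?U)" if S: "S \<subseteq> R - T" for S
      proof -
        have finS: "finite S" using S fin by (auto intro: finite_subset)
        have "card S + card T = card (S \<union> T)"
          using S finS finT by (subst card_Un_disjoint) auto
        also have "\<dots> \<le> card (\<Union>i\<in>S \<union> T. N i)" using S tight by (intro hall) auto
        also have "(\<Union>i\<in>S \<union> T. N i) = (\<Union>i\<in>S. N i - ?U) \<union> ?U" by auto
        also have "card \<dots> = card (\<Union>i\<in>S. N i - ?U) + card ?U"
          using S finS finU fin by (subst card_Un_disjoint) auto
        finally show ?thesis using tight by simp
      qed
    qed (use fin in auto)
    then obtain g where g: "inj_on g (R - T)" "\<forall>i\<in>R - T. g i \<in> N i - ?U" by blast
    let ?h = "\<lambda>i. if i \<in> T then f i else g i"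
    have "inj_on ?h R"
    proof (rule inj_onI)
      fix i j assume ij: "i \<in> R" "j \<in> R" "?h i = ?h j"
      show "i = j"
      proof (cases "i \<in> T \<longleftrightarrow> j \<in> T")
        case True
        then show ?thesis using ij f(1) g(1) by (auto simp: inj_on_def split: if_splits)
      next
        case False
        then show ?thesis
        proof (cases "i \<in> T")
          case True
          then have jT: "j \<notin> T" using False by blast
          have "f i \<in> ?U" using f(2) True by blast
          moreover have "g j \<notin> ?U" using g(2) ij(2) jT by blast
          moreover have "f i = g j" using ij(3) True jT by simp
          ultimately show ?thesis by simp
        next
          case iT: False
          then have jT: "j \<in> T" using False by blast
          have "f j \<in> ?U" using f(2) jT by blast
          moreover have "g i \<notin> ?U" using g(2) ij(1) iT by blast
          moreover have "g i = f j" using ij(3) iT jT by simp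
          ultimately show ?thesis by simp
        qed
      qed
    qed
    moreover have "\<forall>i\<in>R. ?h i \<in> N i" using f g by auto
    ultimately show ?thesis by blast
  next
    case slack
    then obtain r where r: "r \<in> R" by blast
    have "card {r} \<le> card (\<Union>i\<in>{r}. N i)" using r by (intro hall) simp
    then have "N r \<noteq> {}" by auto
    then obtain b where b: "b \<in> N r" by blast
    have "\<exists>g. inj_on g (R - {r}) \<and> (\<forall>i\<in>R - {r}. g i \<in> N i - {b})"
    proof (rule less.hyps)
      show "card (R - {r}) < card R" using r fin by (meson card_Diff1_less)
      show "card S \<le> card (\<Union>i\<in>S. N i - {b})" if S: "S \<subseteq> R - {r}" for S
      proof (cases "S = {}")
        case False
        have "card S < card (\<Union>i\<in>S. N i)" using S r False by (intro slack) auto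
        moreover have "(\<Union>i\<in>S. N i - {b}) = (\<Union>i\<in>S. N i) - {b}" by auto
        moreover have "card (\<Union>i\<in>S. N i) - 1 \<le> card ((\<Union>i\<in>S. N i) - {b})"
          by (simp add: card_Diff_singleton_if)
        ultimately show ?thesis by simp
      qed simp
    qed (use fin in auto)
    then obtain g where g: "inj_on g (R - {r})" "\<forall>i\<in>R - {r}. g i \<in> N i - {b}" by blast
    have "inj_on (g(r := b)) R"
    proof (rule inj_onI)
      fix i j assume "i \<in> R" "j \<in> R" "(g(r := b)) i = (g(r := b)) j"
      then show "i = j" using g by (cases "i = r"; cases "j = r") (auto simp: inj_on_def)
    qed
    moreover have "\<forall>i\<in>R. (g(r := b)) i \<in> N i" using g b by auto
    ultimately show ?thesis by blast
  qed
qed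

text \<open>Rayleigh's principle: the maximum \<open>l\<close> of the quadratic form on the unit
  sphere is an eigenvalue, and it is at least the value \<open>a i i\<close> attained at the unit
  vector of \<open>i\<close>.\<close>

lemma symmetric_nonneg_eigenvalue:
  fixes a :: "'a \<Rightarrow> 'a \<Rightarrow> real"
  assumes U: "finite U" and sym: "\<And>i j. a i j = a j i" and i: "i \<in> U" "0 \<le> a i i"
  shows "\<exists>l x. 0 \<le> l \<and> (\<exists>j\<in>U. x j \<noteq> 0) \<and> (\<forall>j\<in>U. (\<Sum>k\<in>U. a j k * x k) = l * x j)"
proof -
  define form where "form x y = (\<Sum>j\<in>U. x j * (\<Sum>k\<in>U. a j k * y k))" for x y :: "'a \<Rightarrow> real"
  define ip where "ip x y = (\<Sum>j\<in>U. x j * y j)" for x y :: "'a \<Rightarrow> real"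
  have delta_right: "(\<Sum>k\<in>U. g k * (if k = j then 1 else 0)) = g j"
    and delta_left: "(\<Sum>k\<in>U. (if k = j then 1 else 0) * g k) = g j"
    if "j \<in> U" for g :: "'a \<Rightarrow> real" and j
    using U that by (simp_all add: if_distrib if_distribR cong: if_cong)
  \<comment> \<open>Vectors are functions on the whole type; prescribing 0 outside \<open>U\<close>
    and bounding the rest gives a product of compact sets, compact by Tychonoff's theorem.\<close>
  define box where "box = (PiE UNIV (\<lambda>j. if j \<in> U then {-1..1} else {0}) :: ('a \<Rightarrow> real) set)"
  define sphere where "sphere = box \<inter> {x. ip x x = 1}"
  have "compact box"
    unfolding box_def compactin_euclidean_iff[symmetric] euclidean_product_topology[symmetric] compactin_PiE
    by auto
  moreover have "closed {x :: 'a \<Rightarrow> real. ip x x = 1}"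
    unfolding ip_def by (intro closed_Collect_eq continuous_intros continuous_on_product_coordinates)
  ultimately have "compact sphere" unfolding sphere_def by (rule compact_Int_closed)
  moreover have delta: "(\<lambda>j. if j = i then 1 else 0) \<in> sphere"
    using i by (auto simp: sphere_def box_def ip_def delta_right)
  moreover have "continuous_on sphere (\<lambda>x. form x x)"
    unfolding form_def
    by (rule continuous_on_subset[of UNIV]) (intro continuous_intros continuous_on_product_coordinates, simp)
  ultimately obtain x where x: "x \<in> sphere" and max: "\<And>y. y \<in> sphere \<Longrightarrow> form y y \<le> form x x"
    using continuous_attains_sup[of sphere "\<lambda>x. form x x"] by blast
  define l where "l = form x x"
  have "form (\<lambda>j. if j = i then 1 else 0) (\<lambda>j. if j = i then 1 else 0) = a i i"
    using i by (simp add: form_def delta_left delta_right)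
  then have l: "0 \<le> l" using max[OF delta] i unfolding l_def by simp
  have xx: "ip x x = 1" using x by (simp add: sphere_def)
  have bound: "form y y \<le> l * ip y y" for y
  proof (cases "ip y y = 0")
    case True
    then have "\<And>j. j \<in> U \<Longrightarrow> y j = 0" using U by (simp add: ip_def sum_nonneg_eq_0_iff)
    then show ?thesis by (simp add: form_def True)
  next
    case False
    moreover have "0 \<le> ip y y" by (simp add: ip_def sum_nonneg)
    ultimately have pos: "0 < ip y y" by simp
    define r where "r = sqrt (ip y y)"
    have r: "0 < r" "r * r = ip y y" using pos by (auto simp: r_def)
    define y' where "y' j = (if j \<in> U then y j / r else 0)" for j
    have ip': "ip y' y' = 1"
    proof -
      have "ip y' y' = ip y y / (r * r)" by (simp add: ip_def y'_def sum_divide_distrib)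
      then show ?thesis using r pos by simp
    qed
    have "\<bar>y' j\<bar> \<le> 1" if "j \<in> U" for j
    proof -
      have "y' j * y' j \<le> ip y' y'" unfolding ip_def using U that by (intro member_le_sum) auto
      then show ?thesis using ip' by (simp add: power2_eq_square[symmetric] abs_square_le_1)
    qed
    then have "y' j \<in> (if j \<in> U then {-1..1} else {0})" for j
      by (cases "j \<in> U") (force simp: abs_le_iff, simp add: y'_def)
    then have "y' \<in> sphere" using ip' unfolding sphere_def box_def by blast
    then have "form y' y' \<le> l" using max l_def by simp
    moreover have "form y' y' = form y y / (r * r)"
      by (simp add: form_def y'_def sum_divide_distrib sum_distrib_left)
    ultimately show ?thesis using r pos by (simp add: field_simps)
  qed
  have "(\<Sum>k\<in>U. a j k * x k) = l * x j" if j: "j \<in> U" for j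
  proof -
    let ?e = "\<lambda>k. if k = j then 1 else 0 :: real"
    define b where "b = l * x j - (\<Sum>k\<in>U. a j k * x k)"
    define d where "d = l - a j j"
    \<comment> \<open>Moving the maximizer by \<open>t\<close> in direction \<open>j\<close> must
      respect \<open>bound\<close>. The resulting quadratic in \<open>t\<close> has no constant
      term, so its linear coefficient has to vanish.\<close>
    have quad: "0 \<le> 2 * t * b + t * t * d" for t
    proof -
      have 1: "form (\<lambda>k. x k + t * ?e k) (\<lambda>k. x k + t * ?e k)
        = form x x + t * form x ?e + t * form ?e x + t * t * form ?e ?e"
        by (simp add: form_def algebra_simps sum.distrib sum_distrib_left)
      have 2: "ip (\<lambda>k. x k + t * ?e k) (\<lambda>k. x k + t * ?e k) = ip x x + 2 * t * ip x ?e + t * t * ip ?e ?e"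
        by (simp add: ip_def algebra_simps sum.distrib sum_distrib_left)
      have 3: "form ?e ?e = a j j" "ip ?e ?e = 1" "ip x ?e = x j"
        "form x ?e = (\<Sum>k\<in>U. a j k * x k)" "form ?e x = (\<Sum>k\<in>U. a j k * x k)"
        using j sym by (simp_all add: form_def ip_def delta_left delta_right mult.commute)
      show ?thesis
        using bound[of "\<lambda>k. x k + t * ?e k"] unfolding 1 2 3
        by (simp add: xx b_def d_def algebra_simps flip: l_def)
    qed
    have "b = 0"
    proof (rule ccontr)
      assume "b \<noteq> 0"
      \<comment> \<open>With \<open>D\<close> positive and above \<open>d\<close>, the choice
        \<open>t = - b / D\<close> makes the quadratic negative.\<close>
      define D where "D = \<bar>d\<bar> + 1"
      have D: "D > 0" "d < D" by (auto simp: D_def)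
      have "0 \<le> 2 * (- b / D) * b + (- b / D) * (- b / D) * d" by (rule quad)
      also have "\<dots> = (b * b) / (D * D) * (d - 2 * D)" using D by (simp add: field_simps)
      also have "\<dots> < 0" using \<open>b \<noteq> 0\<close> D
        by (intro mult_pos_neg divide_pos_pos) (auto simp: zero_less_mult_iff)
      finally show False by simp
    qed
    then show ?thesis by (simp add: b_def)
  qed
  moreover have "\<exists>j\<in>U. x j \<noteq> 0"
  proof (rule ccontr)
    assume "\<not> ?thesis"
    then have "ip x x = 0" by (simp add: ip_def)
    then show False using xx by simp
  qed
  ultimately show ?thesis using l by blast
qed

subsection \<open>Controllable realizations of a matched pattern\<close>

text \<open>Entries are complex but constrained to be real, so that \<open>controllable\<close>
  applies directly; real matrices are extracted at the end.\<close>

definition fits :: "('a \<Rightarrow> 'a \<Rightarrow> bool) \<Rightarrow> ('a \<Rightarrow> 'b \<Rightarrow> bool) \<Rightarrow> ('a \<Rightarrow> 'a \<Rightarrow> complex) \<Rightarrow> ('a \<Rightarrow> 'b \<Rightarrow> complex) \<Rightarrow> bool" where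
  "fits adj inp A B \<longleftrightarrow>
    (\<forall>i j. A i j = A j i \<and> A i j \<in> \<real> \<and> (A i j \<noteq> 0 \<longrightarrow> adj i j)) \<and>
    (\<forall>i u. B i u \<in> \<real> \<and> (B i u \<noteq> 0 \<longrightarrow> inp i u))"

lemma ex_real_notin_finite:
  assumes "finite (S :: complex set)"
  obtains s :: real where "complex_of_real s \<notin> S"
proof -
  have "finite (complex_of_real -` S)"
    by (rule finite_vimageI[OF assms]) (simp add: inj_on_def)
  then show thesis using that ex_new_if_finite[OF infinite_UNIV_char_0] by (metis vimageI)
qed

text \<open>\<open>f\<close> is a matching of states to in-neighbours, with \<open>Inl\<close> for
  states and \<open>Inr\<close> for inputs.\<close>

locale matched_pattern =
  fixes R :: "'a set" and adj :: "'a \<Rightarrow> 'a \<Rightarrow> bool" and inp :: "'a \<Rightarrow> 'b \<Rightarrow> bool" and f :: "'a \<Rightarrow> 'a + 'b"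
  assumes fin: "finite R"
    and adj_sym: "adj i j \<Longrightarrow> adj j i"
    and f_inj: "inj_on f R"
    and f_adj: "i \<in> R \<Longrightarrow> f i = Inl j \<Longrightarrow> j \<in> R \<and> adj i j"
    and f_inp: "i \<in> R \<Longrightarrow> f i = Inr u \<Longrightarrow> inp i u"
begin

text \<open>The states whose \<open>f\<close>-path ends in an input. The number counts the states
  passed after the first one and serves as induction measure.\<close>

inductive stem :: "nat \<Rightarrow> 'a \<Rightarrow> bool" where
  last: "i \<in> R \<Longrightarrow> f i = Inr u \<Longrightarrow> stem 0 i"
| step: "i \<in> R \<Longrightarrow> f i = Inl j \<Longrightarrow> stem d j \<Longrightarrow> stem (Suc d) i"

definition stems :: "'a set" where
  "stems = {i. \<exists>d. stem d i}"

text \<open>Closed under \<open>f\<close> and under preimages: a union of whole paths and cycles of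
  the matching.\<close>

definition f_closed :: "'a set \<Rightarrow> bool" where
  "f_closed V \<longleftrightarrow> V \<subseteq> R \<and> (\<forall>i\<in>R. \<forall>j. f i = Inl j \<longrightarrow> (i \<in> V \<longleftrightarrow> j \<in> V))"

lemma stem_in: "stem d i \<Longrightarrow> i \<in> R"
  by (erule stem.cases) auto

lemma stem_Inl: "stem d i \<Longrightarrow> f i = Inl j \<Longrightarrow> \<exists>e. d = Suc e \<and> stem e j"
  by (erule stem.cases) auto

lemma stems_subset: "stems \<subseteq> R"
  by (auto simp: stems_def intro: stem_in)

lemma f_closed_stems: "f_closed stems"
proof -
  have "j \<in> stems" if "i \<in> stems" "f i = Inl j" for i j
    using that stem_Inl by (fastforce simp: stems_def)
  moreover have "i \<in> stems" if "j \<in> stems" "i \<in> R" "f i = Inl j" for i j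
    using that by (auto simp: stems_def intro: step)
  ultimately show ?thesis unfolding f_closed_def using stems_subset by blast
qed

text \<open>Zeros propagate from the input end. Injectivity of \<open>f\<close> makes the output at
  \<open>u\<close> read a single state. Further back, row \<open>j\<close> of the eigenvector
  equation contains only the predecessor \<open>i\<close> of \<open>j\<close> and the successor of
  \<open>j\<close>, which is already known to be 0.\<close>

lemma controllable_stems: "\<exists>A B. fits adj inp A B \<and> controllable stems A B"
proof -
  define A :: "'a \<Rightarrow> 'a \<Rightarrow> complex" where
    "A i j = (if i \<in> stems \<and> j \<in> stems \<and> (f i = Inl j \<or> f j = Inl i) then 1 else 0)" for i j
  define B :: "'a \<Rightarrow> 'b \<Rightarrow> complex" where
    "B i u = (if i \<in> stems \<and> f i = Inr u then 1 else 0)" for i u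
  have finV: "finite stems" using stems_subset fin by (rule finite_subset)
  have "adj i j" if "A i j \<noteq> 0" for i j
    using that stems_subset f_adj adj_sym by (auto simp: A_def split: if_splits)
  moreover have "inp i u" if "B i u \<noteq> 0" for i u
    using that stems_subset f_inp by (auto simp: B_def split: if_splits)
  ultimately have "fits adj inp A B" by (auto simp: fits_def A_def B_def)
  moreover have "controllable stems A B"
  proof (rule controllableI)
    fix z x i0
    assume eig: "\<And>i. i \<in> stems \<Longrightarrow> matvec stems A x i = z * x i"
      and outp: "\<And>u. (\<Sum>j\<in>stems. B j u * x j) = 0" and "i0 \<in> stems"
    have "stem d i \<Longrightarrow> x i = 0" for d i
    proof (induction d arbitrary: i rule: less_induct)
      case (less d)
      have i: "i \<in> R" "i \<in> stems" using less.prems stem_in by (auto simp: stems_def)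
      from less.prems show ?case
      proof cases
        case (last u)
        have "B j u * x j = (if j = i then x i else 0)" if "j \<in> stems" for j
        proof (cases "j = i")
          case True
          then show ?thesis using last(3) i by (simp add: B_def)
        next
          case False
          then have "f j \<noteq> Inr u"
            using inj_onD[OF f_inj, of j i] that i last(3) stems_subset by auto
          then show ?thesis using False by (simp add: B_def)
        qed
        then have "(\<Sum>j\<in>stems. B j u * x j) = (\<Sum>j\<in>stems. if j = i then x i else 0)"
          by (rule sum.cong[OF refl])
        then show ?thesis using outp[of u] finV i by simp
      next
        case (step j e)
        have j: "j \<in> stems" using step by (auto simp: stems_def)
        have xj: "x j = 0" using step by (intro less.IH) auto
        have "matvec stems A x j = (\<Sum>k\<in>stems. if k = i then x i else 0)"
          unfolding matvec_def
        proof (rule sum.cong)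
          fix k assume k: "k \<in> stems"
          show "A j k * x k = (if k = i then x i else 0)"
          proof (cases "k = i")
            case True
            then show ?thesis using j i step by (simp add: A_def)
          next
            case False
            then have "f k \<noteq> Inl j"
              using inj_onD[OF f_inj, of k i] k i step stems_subset by auto
            moreover have "x k = 0" if "f j = Inl k"
            proof -
              from \<open>stem e j\<close> that obtain e' where "e = Suc e'" "stem e' k"
                using stem_Inl by blast
              then show ?thesis using step by (intro less.IH[of e']) auto
            qed
            ultimately show ?thesis using False by (auto simp: A_def)
          qed
        qed simp
        then show ?thesis using eig[OF j] xj finV i by simp
      qed
    qed
    then show "x i0 = 0" using \<open>i0 \<in> stems\<close> by (auto simp: stems_def)
  qed
  ultimately show ?thesis by blast
qed

text \<open>The \<open>f\<close>-orbit of \<open>c\<close> stays outside \<open>V\<close> and never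
  meets an input. It is finite, and by injectivity its first repetition is a return to
  \<open>c\<close>.\<close>

lemma cycle_through:
  assumes V: "f_closed V" "stems \<subseteq> V" and c: "c \<in> R" "c \<notin> V"
  obtains p L where "0 < L" "inj_on p {..<L}" "p 0 = c" "p ` {..<L} \<subseteq> R - V"
    "f_closed (p ` {..<L})" "\<And>k. adj (p k) (p (Suc k))" "p L = c"
proof -
  define g where "g i = projl (f i)" for i
  \<comment> \<open>A state matched to an input is a stem and hence lies in
    \<open>V\<close>.\<close>
  have fg: "f i = Inl (g i)" if "i \<in> R - V" for i
    using that V(2) by (cases "f i") (auto simp: g_def stems_def intro: stem.last)
  have gR: "g i \<in> R - V" if "i \<in> R - V" for i
    using that fg[OF that] f_adj V(1) by (auto simp: f_closed_def)
  have g_inj: "i = j" if "i \<in> R - V" "j \<in> R - V" "g i = g j" for i j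
    using that fg inj_onD[OF f_inj, of i j] by auto
  define p where "p k = (g ^^ k) c" for k
  have p0: "p 0 = c" and pS: "p (Suc k) = g (p k)" for k by (auto simp: p_def)
  have pR: "p k \<in> R - V" for k
    by (induction k) (use c gR in \<open>auto simp: p0 pS\<close>)
  \<comment> \<open>Injectivity cancels common steps, so a coincidence of orbit points moves back to
    the start.\<close>
  have shift: "p (b - a) = c" if "a \<le> b" "p a = p b" for a b
    using that
  proof (induction a arbitrary: b)
    case 0
    then show ?case by (simp add: p0)
  next
    case (Suc a)
    then obtain b' where b: "b = Suc b'" by (cases b) auto
    then have "p a = p b'" using Suc.prems g_inj pR pS by metis
    then show ?case using Suc b by simp
  qed
  have "\<not> inj p"
  proof
    assume "inj p"
    then have "infinite (range p)" by (simp add: range_inj_infinite)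
    moreover have "range p \<subseteq> R" using pR by auto
    ultimately show False using fin finite_subset by blast
  qed
  then obtain a b where "a < b" "p a = p b"
    by (metis injI linorder_neqE_nat)
  then have ex: "0 < b - a \<and> p (b - a) = c" using shift[of a b] by simp
  define L where "L = (LEAST L. 0 < L \<and> p L = c)"
  have L: "0 < L" "p L = c" using LeastI[of "\<lambda>L. 0 < L \<and> p L = c", OF ex] by (auto simp: L_def)
  have L_min: "L \<le> k" if "0 < k" "p k = c" for k
    unfolding L_def using that by (intro Least_le) simp
  have inj: "inj_on p {..<L}"
  proof (rule linorder_inj_onI)
    show "p a \<noteq> p b" if "a < b" "a \<in> {..<L}" "b \<in> {..<L}" for a b
      using that shift[of a b] L_min[of "b - a"] by auto
  qed auto
  have "f_closed (p ` {..<L})"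
    unfolding f_closed_def
  proof (intro conjI ballI allI impI)
    show "p ` {..<L} \<subseteq> R" using pR by auto
    fix i j assume i: "i \<in> R" and ij: "f i = Inl j"
    \<comment> \<open>The successor of the last vertex \<open>p (L - 1)\<close> is
      \<open>p L\<close>, which is \<open>p 0\<close> again.\<close>
    have pc: "p (Suc k) \<in> p ` {..<L}" if "k < L" for k
      using that L p0 by (cases "Suc k = L") (auto intro: image_eqI[of _ _ 0])
    show "i \<in> p ` {..<L} \<longleftrightarrow> j \<in> p ` {..<L}"
    proof
      assume "i \<in> p ` {..<L}"
      then obtain k where k: "k < L" "i = p k" by auto
      then have "j = p (Suc k)" using fg[OF pR[of k]] ij pS by simp
      then show "j \<in> p ` {..<L}" using pc k by simp
    next
      assume "j \<in> p ` {..<L}"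
      then obtain k where k: "k < L" "j = p k" by auto
      obtain l where l: "l < L" "j = p (Suc l)"
      proof (cases k)
        case 0
        then show thesis using that[of "L - 1"] L k p0 by simp
      next
        case (Suc l)
        then show thesis using that[of l] k by simp
      qed
      then have "f (p l) = f i" using fg[OF pR[of l]] ij pS by simp
      then have "i = p l" using inj_onD[OF f_inj, of "p l" i] pR[of l] i by auto
      then show "i \<in> p ` {..<L}" using l by simp
    qed
  qed
  moreover have "adj (p k) (p (Suc k))" for k
    using f_adj[of "p k" "p (Suc k)"] fg[OF pR[of k]] pR[of k] pS by auto
  moreover have "p ` {..<L} \<subseteq> R - V" using pR by auto
  ultimately show thesis using that[of L p] L inj p0 by blast
qed

lemma extend_by_cycle:
  assumes V: "f_closed V" "stems \<subseteq> V" and c: "c \<in> R" "c \<notin> V"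
    and link: "(\<exists>u. inp c u) \<or> (\<exists>v\<in>V. adj v c)"
    and AB: "fits adj inp A B" "controllable V A B"
  shows "\<exists>V' A' B'. f_closed V' \<and> V \<subset> V' \<and> fits adj inp A' B' \<and> controllable V' A' B'"
proof -
  obtain p L where L: "0 < L" and p: "inj_on p {..<L}" "p 0 = c" "p ` {..<L} \<subseteq> R - V"
    "f_closed (p ` {..<L})" "\<And>k. adj (p k) (p (Suc k))" "p L = c"
    using cycle_through[OF V c] by metis
  define C where "C = p ` {..<L}"
  \<comment> \<open>The cycle matrix carried over to the vertices; position 0, where the rooted test
    holds, corresponds to \<open>c\<close>, where the link is attached.\<close>
  define M where "M i j = cycle_matrix L (inv_into {..<L} p i) (inv_into {..<L} p j)" for i j
  have M: "nonsingular_on C M" "rooted_controllable C M c"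
    unfolding C_def M_def[abs_def] p(2)[symmetric]
    by (rule nonsingular_on_inv_into[OF p(1) nonsingular_cycle_matrix[OF L]],
        rule rooted_controllable_inv_into[OF p(1) rooted_controllable_cycle_matrix[OF L]])
  have M_fits: "M i j = M j i" "M i j \<in> \<real>" for i j
    by (auto simp: M_def cycle_matrix_def)
  have M_adj: "adj i j" if ij: "i \<in> C" "j \<in> C" "M i j \<noteq> 0" for i j
  proof -
    obtain k l where k: "k < L" "i = p k" and l: "l < L" "j = p l" using ij by (auto simp: C_def)
    have "cycle_matrix L k l \<noteq> 0" using ij k l p(1) by (simp add: M_def inv_into_f_f)
    \<comment> \<open>The first two cases are the closing edge, from \<open>p (L - 1)\<close> to
      \<open>p L = c\<close>; for \<open>L = 1\<close> it is a self-loop.\<close>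
    then consider "k = 0" "l = L - 1" | "k = L - 1" "l = 0" | "k = Suc l" | "l = Suc k"
      by (auto simp: cycle_matrix_def split: if_splits)
    then show ?thesis
    proof cases
      case 1
      then show ?thesis using p(5)[of "L - 1"] p(2,6) k l L adj_sym by simp
    next
      case 2
      then show ?thesis using p(5)[of "L - 1"] p(2,6) k l L by simp
    next
      case 3
      then show ?thesis using p(5)[of l] k l adj_sym by simp
    next
      case 4
      then show ?thesis using p(5)[of k] k l by simp
    qed
  qed
  have finV: "finite V" using V(1) fin finite_subset by (auto simp: f_closed_def)
  have disj: "V \<inter> C = {}" using p(3) by (auto simp: C_def)
  have cC: "c \<in> C" using L p(2) by (auto simp: C_def)
  \<comment> \<open>A single link of weight 1: to an input if one acts on \<open>c\<close>,
    otherwise to a neighbour in \<open>V\<close>.\<close>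
  obtain a :: "'a \<Rightarrow> complex" and b :: "'b \<Rightarrow> complex" where
    nz: "(\<exists>i\<in>V. a i \<noteq> 0) \<or> (\<exists>u. b u \<noteq> 0)" and real: "\<And>i. a i \<in> \<real>" "\<And>u. b u \<in> \<real>"
    and ab: "\<And>i. a i \<noteq> 0 \<Longrightarrow> adj i c" "\<And>u. b u \<noteq> 0 \<Longrightarrow> inp c u"
  proof (cases "\<exists>u. inp c u")
    case True
    then obtain u where "inp c u" ..
    then show thesis by (intro that[of "\<lambda>_. 0" "\<lambda>w. if w = u then 1 else 0"]) (auto split: if_splits)
  next
    case False
    then obtain v where "v \<in> V" "adj v c" using link by blast
    then show thesis by (intro that[of "\<lambda>i. if i = v then 1 else 0" "\<lambda>_. 0"]) (auto split: if_splits)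
  qed
  have finC: "finite C" by (simp add: C_def)
  obtain s :: real where "complex_of_real s \<notin>
      {s. \<not> controllable (V \<union> C) (join_states V C c a A (\<lambda>i j. s * M i j)) (join_inputs V c b B)}"
    by (rule ex_real_notin_finite[OF controllable_join[OF finV finC disj cC AB(2) M nz]])
  then have s: "controllable (V \<union> C) (join_states V C c a A (\<lambda>i j. of_real s * M i j)) (join_inputs V c b B)"
    by simp
  note A = AB(1)[unfolded fits_def, THEN conjunct1, THEN spec, THEN spec]
    and B = AB(1)[unfolded fits_def, THEN conjunct2, THEN spec, THEN spec]
  define A' where "A' = join_states V C c a A (\<lambda>i j. of_real s * M i j)"
  define B' where "B' = join_inputs V c b B"
  have A'_sym: "A' i j = A' j i" for i j
    using A[of i j, THEN conjunct1] M_fits(1)[of i j] c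
    unfolding A'_def join_states_def by (cases "i \<in> V"; cases "j \<in> V") simp_all
  have A'_real: "A' i j \<in> \<real>" for i j
    using A[of i j, THEN conjunct2, THEN conjunct1] M_fits(2)[of i j] real(1)
    by (simp add: A'_def join_states_def)
  have A'_adj: "adj i j" if "A' i j \<noteq> 0" for i j
    using that A[of i j, THEN conjunct2, THEN conjunct2] M_adj[of i j] ab(1)[of i] ab(1)[of j] adj_sym[of j c]
    by (simp add: A'_def join_states_def split: if_splits)
  have B'_real: "B' i u \<in> \<real>" and B'_inp: "B' i u \<noteq> 0 \<Longrightarrow> inp i u" for i u
    using B[of i u] real(2) ab(2)[of u] by (simp_all add: B'_def join_inputs_def split: if_splits)
  have "fits adj inp A' B'"
    unfolding fits_def using A'_adj B'_inp by (intro conjI allI impI A'_sym A'_real B'_real)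
  moreover have "f_closed (V \<union> C)" using V(1) p(4) by (auto simp: f_closed_def C_def)
  moreover have "V \<subset> V \<union> C" using cC c by blast
  ultimately show ?thesis using s unfolding A'_def B'_def by blast
qed

text \<open>Starting from the stems, the cycle through a linkable vertex is added until
  \<open>R\<close> is exhausted. The hypothesis is the form in which reachability from the inputs is
  used.\<close>

lemma controllable_pattern:
  assumes connected: "\<And>V. V \<subset> R \<Longrightarrow> \<exists>c\<in>R - V. (\<exists>u. inp c u) \<or> (\<exists>v\<in>V. adj v c)"
  shows "\<exists>A B. fits adj inp A B \<and> controllable R A B"
proof -
  have "f_closed V \<Longrightarrow> stems \<subseteq> V \<Longrightarrow> fits adj inp A B \<Longrightarrow> controllable V A B \<Longrightarrow> ?thesis" for V A B
  proof (induction "card (R - V)" arbitrary: V A B rule: less_induct)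
    case less
    show ?case
    proof (cases "V = R")
      case True
      then show ?thesis using less.prems by blast
    next
      case False
      then have "V \<subset> R" using less.prems(1) by (auto simp: f_closed_def)
      from connected[OF this] obtain c where c: "c \<in> R" "c \<notin> V"
        and link: "(\<exists>u. inp c u) \<or> (\<exists>v\<in>V. adj v c)" by blast
      from extend_by_cycle[OF less.prems(1,2) c link less.prems(3,4)]
      obtain V' A' B' where V': "f_closed V'" "V \<subset> V'"
        and AB': "fits adj inp A' B'" "controllable V' A' B'" by (elim exE conjE)
      have "card (R - V') < card (R - V)"
        using V' fin by (intro psubset_card_mono) (auto simp: f_closed_def)
      moreover have "stems \<subseteq> V'" using V'(2) less.prems(2) by blast
      ultimately show ?thesis using less.hyps V'(1) AB' by blast
    qed
  qed
  moreover obtain A B where "fits adj inp A B" "controllable stems A B"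
    using controllable_stems by blast
  ultimately show ?thesis using f_closed_stems by blast
qed

end

subsection \<open>Structural stabilizability\<close>

text \<open>Symmetry of \<open>A\<close> turns left eigenvectors into right ones, which gives the
  form tested by \<open>controllable\<close>.\<close>

lemma uncontrollable_eigenvalue_iff:
  assumes A: "A \<in> carrier_mat n n" "transpose_mat A = A" and B: "B \<in> carrier_mat n m"
  shows "uncontrollable_eigenvalue A B z \<longleftrightarrow>
    (\<exists>x. (\<exists>i<n. x i \<noteq> 0) \<and> (\<forall>i<n. (\<Sum>j<n. complex_of_real (A $$ (i, j)) * x j) = z * x i) \<and>
      (\<forall>u<m. (\<Sum>j<n. complex_of_real (B $$ (j, u)) * x j) = 0))"
    (is "_ \<longleftrightarrow> (\<exists>x. ?P x)")
proof -
  have sym: "transpose_mat (complex_mat A) = complex_mat A"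
    using A(2) by (metis map_mat_transpose)
  have rowA: "(complex_mat A *\<^sub>v v) $ i = (\<Sum>j<n. complex_of_real (A $$ (i, j)) * v $ j)"
    if "v \<in> carrier_vec n" "i < n" for v i
    using that A(1) by (auto simp: scalar_prod_def lessThan_atLeast0 intro!: sum.cong)
  have rowB: "(transpose_mat (complex_mat B) *\<^sub>v v) $ u = (\<Sum>j<n. complex_of_real (B $$ (j, u)) * v $ j)"
    if "v \<in> carrier_vec n" "u < m" for v u
    using that B by (auto simp: scalar_prod_def lessThan_atLeast0 intro!: sum.cong)
  have eq: "eigenvector (complex_mat A) v z \<and> transpose_mat (complex_mat B) *\<^sub>v v = 0\<^sub>v (dim_col B)
    \<longleftrightarrow> v \<in> carrier_vec n \<and> ?P (\<lambda>i. v $ i)" for v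
  proof (cases "v \<in> carrier_vec n")
    case v: True
    have "v \<noteq> 0\<^sub>v n \<longleftrightarrow> (\<exists>i<n. v $ i \<noteq> 0)"
      using v by (auto simp: vec_eq_iff)
    moreover have "complex_mat A *\<^sub>v v = z \<cdot>\<^sub>v v \<longleftrightarrow>
        (\<forall>i<n. (\<Sum>j<n. complex_of_real (A $$ (i, j)) * v $ j) = z * v $ i)"
      using v A(1) rowA[OF v] by (auto simp: vec_eq_iff simp del: index_mult_mat_vec)
    moreover have "transpose_mat (complex_mat B) *\<^sub>v v = 0\<^sub>v (dim_col B) \<longleftrightarrow>
        (\<forall>u<m. (\<Sum>j<n. complex_of_real (B $$ (j, u)) * v $ j) = 0)"
      using v B rowB[OF v] by (auto simp: vec_eq_iff simp del: index_mult_mat_vec)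
    ultimately show ?thesis using v A(1) by (simp add: eigenvector_def)
  next
    case False
    then show ?thesis using A(1) by (simp add: eigenvector_def)
  qed
  have unc: "uncontrollable_eigenvalue A B z \<longleftrightarrow> (\<exists>v. v \<in> carrier_vec n \<and> ?P (\<lambda>i. v $ i))"
    unfolding uncontrollable_eigenvalue_def sym eigenvalue_def eq[symmetric] by (rule iffI) auto
  show ?thesis
  proof
    assume "uncontrollable_eigenvalue A B z"
    then obtain v where v: "v \<in> carrier_vec n \<and> ?P (\<lambda>i. v $ i)" unfolding unc by (rule exE)
    show "\<exists>x. ?P x" by (rule exI[of _ "\<lambda>i. v $ i"]) (rule v[THEN conjunct2])
  next
    assume "\<exists>x. ?P x"
    then obtain x where "?P x" by (elim exE)
    then have "?P (\<lambda>i. vec n x $ i)" by auto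
    then show "uncontrollable_eigenvalue A B z"
      unfolding unc by (intro exI[of _ "vec n x"] conjI[OF vec_carrier])
  qed
qed

section \<open>Digraph notions as relations on indices\<close>

locale structural_pair =
  fixes A B :: "entry mat" and n m :: nat
  assumes carrier_A: "A \<in> carrier_mat n n"
    and symmetric_A: "symmetrically_structured A"
    and carrier_B: "B \<in> carrier_mat n m"
begin

text \<open>The index bounds are included because \<open>fits\<close> constrains the entries at all
  natural numbers.\<close>

definition adj :: "nat \<Rightarrow> nat \<Rightarrow> bool" where
  "adj i j \<longleftrightarrow> i < n \<and> j < n \<and> A $$ (i, j) = Star"

definition inp :: "nat \<Rightarrow> nat \<Rightarrow> bool" where
  "inp i u \<longleftrightarrow> i < n \<and> u < m \<and> B $$ (i, u) = Star"

definition reach :: "nat set" where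
  "reach = {i. State i \<in> input_reachable A B}"

lemma adj_sym: "adj i j \<Longrightarrow> adj j i"
proof -
  assume "adj i j"
  moreover have "transpose_mat A $$ (i, j) = A $$ (j, i)" if "i < n" "j < n"
    using that carrier_A by simp
  ultimately show "adj j i"
    using symmetric_A by (simp add: adj_def symmetrically_structured_def)
qed

lemma state_edge_iff: "(State j, State i) \<in> edges A B \<longleftrightarrow> adj i j"
  using carrier_A by (auto simp: edges_def state_edges_def input_edges_def adj_def)

lemma input_edge_iff: "(Input u, State i) \<in> edges A B \<longleftrightarrow> inp i u"
  using carrier_B by (auto simp: edges_def state_edges_def input_edges_def inp_def)

lemma edge_target: "(x, y) \<in> edges A B \<Longrightarrow> \<exists>i<n. y = State i"
  using carrier_A carrier_B by (auto simp: edges_def state_edges_def input_edges_def)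

lemma reach_less: "i \<in> reach \<Longrightarrow> i < n"
  using carrier_A by (auto simp: reach_def input_reachable_def state_vertices_def)

lemma finite_reach: "finite reach"
  by (rule finite_subset[of _ "{..<n}"]) (use reach_less in auto)

lemma input_reachable_eq: "input_reachable A B = State ` reach"
  by (auto simp: reach_def input_reachable_def state_vertices_def)

lemma reach_iff:
  "i \<in> reach \<longleftrightarrow> i < n \<and> (\<exists>u<m. (Input u, State i) \<in> (edges A B)\<^sup>*)"
  using carrier_A carrier_B
  by (auto simp: reach_def input_reachable_def state_vertices_def input_vertices_def)

lemma reach_inp: "inp i u \<Longrightarrow> i \<in> reach"
  unfolding reach_iff by (metis input_edge_iff inp_def r_into_rtrancl)

text \<open>State edges can be traversed both ways, so reachability spreads in both directions; this
  decouples reachable from unreachable states.\<close>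

lemma reach_adj: "i \<in> reach \<Longrightarrow> adj i j \<Longrightarrow> j \<in> reach"
  unfolding reach_iff by (metis adj_sym state_edge_iff adj_def rtrancl.rtrancl_into_rtrancl)

text \<open>A path from an input to a reachable state outside \<open>V\<close> has a first state
  outside \<open>V\<close>; without a link into the complement, no path could leave
  \<open>V\<close>.\<close>

lemma reach_connected:
  assumes V: "V \<subset> reach"
  shows "\<exists>c\<in>reach - V. (\<exists>u. inp c u) \<or> (\<exists>v\<in>V. adj v c)"
proof (rule ccontr)
  assume contra: "\<not> ?thesis"
  obtain r where r: "r \<in> reach" "r \<notin> V" using V by blast
  then obtain u where "(Input u, State r) \<in> (edges A B)\<^sup>*" unfolding reach_iff by blast
  moreover have "y = Input u \<or> (\<exists>i\<in>V. y = State i)" if "(Input u, y) \<in> (edges A B)\<^sup>*" for y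
    using that
  proof (induction rule: rtrancl_induct)
    case base
    then show ?case by simp
  next
    case (step y w)
    from edge_target[OF step.hyps(2)] obtain c where w: "w = State c" by blast
    from step.IH show ?case
    proof
      assume "y = Input u"
      then have "inp c u" using step.hyps(2) w input_edge_iff by simp
      then show ?thesis using contra reach_inp w by blast
    next
      assume "\<exists>i\<in>V. y = State i"
      then obtain v where v: "v \<in> V" "y = State v" by blast
      then have "adj v c" using step.hyps(2) w state_edge_iff adj_sym by simp
      moreover have "c \<in> reach" using reach_adj[of v c] \<open>adj v c\<close> v V by blast
      ultimately show ?thesis using contra v w by blast
    qed
  qed
  ultimately show False using r by blast
qed

text \<open>In-neighbours in the sum type that the matching of \<open>matched_pattern\<close> takes
  its values in.\<close>

definition nbrs :: "nat \<Rightarrow> (nat + nat) set" where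
  "nbrs i = Inl ` {j. adj i j} \<union> Inr ` {u. inp i u}"

lemma finite_nbrs: "finite (nbrs i)"
proof -
  have "{j. adj i j} \<subseteq> {..<n}" "{u. inp i u} \<subseteq> {..<m}" by (auto simp: adj_def inp_def)
  then show ?thesis by (auto simp: nbrs_def intro: finite_subset)
qed

lemma card_in_neighbours: "card (in_neighbours A B (State ` S)) = card (\<Union>i\<in>S. nbrs i)"
proof -
  define vert :: "nat + nat \<Rightarrow> vertex" where "vert = case_sum State Input"
  have "inj vert" by (rule injI) (auto simp: vert_def split: sum.splits)
  have "in_neighbours A B (State ` S) = vert ` (\<Union>i\<in>S. nbrs i)"
  proof
    show "in_neighbours A B (State ` S) \<subseteq> vert ` (\<Union>i\<in>S. nbrs i)"
    proof
      fix v assume "v \<in> in_neighbours A B (State ` S)"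
      then obtain i where i: "i \<in> S" "(v, State i) \<in> edges A B" by (auto simp: in_neighbours_def)
      show "v \<in> vert ` (\<Union>i\<in>S. nbrs i)"
      proof (cases v)
        case (State j)
        then have "Inl j \<in> nbrs i" using i state_edge_iff by (simp add: nbrs_def)
        then show ?thesis using i State by (auto simp: vert_def intro!: image_eqI[of _ _ "Inl j"])
      next
        case (Input u)
        then have "Inr u \<in> nbrs i" using i input_edge_iff by (simp add: nbrs_def)
        then show ?thesis using i Input by (auto simp: vert_def intro!: image_eqI[of _ _ "Inr u"])
      qed
    qed
    show "vert ` (\<Union>i\<in>S. nbrs i) \<subseteq> in_neighbours A B (State ` S)"
    proof
      fix v assume "v \<in> vert ` (\<Union>i\<in>S. nbrs i)"
      then obtain i where i: "i \<in> S" "(\<exists>j. v = State j \<and> adj i j) \<or> (\<exists>u. v = Input u \<and> inp i u)"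
        by (auto simp: vert_def nbrs_def)
      then have "(v, State i) \<in> edges A B" using state_edge_iff input_edge_iff by auto
      moreover have "v \<in> state_vertices A \<union> input_vertices B"
        using i carrier_A carrier_B
        by (auto simp: state_vertices_def input_vertices_def adj_def inp_def)
      ultimately show "v \<in> in_neighbours A B (State ` S)" using i by (auto simp: in_neighbours_def)
    qed
  qed
  then show ?thesis using \<open>inj vert\<close> by (simp add: card_image inj_on_subset)
qed

lemma unreachable_loop_iff:
  "(\<forall>x\<in>input_unreachable A B. (x, x) \<in> edges A B) \<longleftrightarrow> (\<forall>i<n. i \<notin> reach \<longrightarrow> adj i i)"
proof -
  have "input_unreachable A B = State ` ({..<n} - reach)"
    using carrier_A by (auto simp: input_unreachable_def input_reachable_eq state_vertices_def)
  then show ?thesis by (auto simp: state_edge_iff)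
qed

lemma reachable_subset_card_iff:
  "(\<forall>S. S \<subseteq> input_reachable A B \<longrightarrow> card (in_neighbours A B S) \<ge> card S) \<longleftrightarrow>
    (\<forall>T. T \<subseteq> reach \<longrightarrow> card T \<le> card (\<Union>i\<in>T. nbrs i))"
proof -
  have "card (State ` T) = card T" for T by (rule card_image) (simp add: inj_on_def)
  then show ?thesis
    unfolding input_reachable_eq by (simp add: card_in_neighbours all_subset_image)
qed

section \<open>The two implications\<close>

lemma structurally_stabilizableI:
  assumes loops: "\<And>i. i < n \<Longrightarrow> i \<notin> reach \<Longrightarrow> adj i i"
    and hall: "\<And>T. T \<subseteq> reach \<Longrightarrow> card T \<le> card (\<Union>i\<in>T. nbrs i)"
  shows "structurally_stabilizable A B"
proof -
  obtain f where f: "inj_on f reach" "\<And>i. i \<in> reach \<Longrightarrow> f i \<in> nbrs i"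
    using hall_marriage[OF finite_reach finite_nbrs hall] by blast
  interpret matched_pattern reach adj inp f
  proof
    show "j \<in> reach \<and> adj i j" if "i \<in> reach" "f i = Inl j" for i j
      using that f(2)[of i] reach_adj by (auto simp: nbrs_def)
    show "inp i u" if "i \<in> reach" "f i = Inr u" for i u
      using that f(2)[of i] by (auto simp: nbrs_def)
  qed (use finite_reach f(1) adj_sym in auto)
  obtain a b where ab: "fits adj inp a b" "controllable reach a b"
    using controllable_pattern[OF reach_connected] by blast
  note a = ab(1)[unfolded fits_def, THEN conjunct1, THEN spec, THEN spec]
    and b = ab(1)[unfolded fits_def, THEN conjunct2, THEN spec, THEN spec]
  have of_real_a: "complex_of_real (Re (a i j)) = a i j" for i j
    using a[of i j, THEN conjunct2, THEN conjunct1] by (rule of_real_Re)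
  have of_real_b: "complex_of_real (Re (b i u)) = b i u" for i u
    using b[of i u, THEN conjunct1] by (rule of_real_Re)
  define A' where "A' = mat n n (\<lambda>(i, j). if i \<in> reach \<and> j \<in> reach then Re (a i j)
    else if i = j then - 1 else 0)"
  define B' where "B' = mat n m (\<lambda>(i, u). if i \<in> reach then Re (b i u) else 0)"
  have A'_carrier: "A' \<in> carrier_mat n n" and B'_carrier: "B' \<in> carrier_mat n m"
    by (simp_all add: A'_def B'_def)
  have sym: "transpose_mat A' = A'"
  proof (rule eq_matI)
    fix i j assume "i < dim_row A'" "j < dim_col A'"
    then show "transpose_mat A' $$ (i, j) = A' $$ (i, j)"
      using a[of i j, THEN conjunct1] by (simp add: A'_def)
  qed (simp_all add: A'_def)
  have "realization A A'"
    unfolding realization_def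
  proof (intro conjI allI impI)
    fix i j assume ij: "i < dim_row A" "j < dim_col A" "A $$ (i, j) = Zero"
    then have "\<not> adj i j" by (simp add: adj_def)
    then show "A' $$ (i, j) = 0"
      using ij loops[of i] a[of i j, THEN conjunct2, THEN conjunct2] carrier_A by (auto simp: A'_def)
  qed (use A'_carrier carrier_A in auto)
  then have "symmetric_realization A A'" using sym by (simp add: symmetric_realization_def)
  moreover have "realization B B'"
    unfolding realization_def
  proof (intro conjI allI impI)
    fix i u assume iu: "i < dim_row B" "u < dim_col B" "B $$ (i, u) = Zero"
    then have "\<not> inp i u" by (simp add: inp_def)
    then show "B' $$ (i, u) = 0"
      using iu b[of i u] carrier_B by (auto simp: B'_def)
  qed (use B'_carrier carrier_B in auto)
  moreover have "stabilizable A' B'"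
    unfolding stabilizable_def uncontrollable_eigenvalue_iff[OF A'_carrier sym B'_carrier]
  proof (intro allI impI, elim exE conjE)
    fix z x i
    assume i: "i < n" "x i \<noteq> 0"
      and eig: "\<forall>i<n. (\<Sum>j<n. complex_of_real (A' $$ (i, j)) * x j) = z * x i"
      and outp: "\<forall>u<m. (\<Sum>j<n. complex_of_real (B' $$ (j, u)) * x j) = 0"
    have sub: "reach \<subseteq> {..<n}" using reach_less by auto
    have "x k = 0" if "k \<in> reach" for k
    proof (rule controllableD[OF ab(2) _ _ that])
      fix k assume k: "k \<in> reach"
      have "matvec reach a x k = (\<Sum>j<n. complex_of_real (A' $$ (k, j)) * x j)"
        unfolding matvec_def
      proof (rule sum.mono_neutral_cong_left)
        show "\<forall>j\<in>{..<n} - reach. complex_of_real (A' $$ (k, j)) * x j = 0"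
          using k reach_less by (auto simp: A'_def)
        show "a k j * x j = complex_of_real (A' $$ (k, j)) * x j" if "j \<in> reach" for j
          using that k reach_less by (simp add: A'_def of_real_a)
      qed (use sub in auto)
      then show "matvec reach a x k = z * x k" using eig reach_less k by simp
    next
      fix u
      show "(\<Sum>j\<in>reach. b j u * x j) = 0"
      proof (cases "u < m")
        case True
        have "(\<Sum>j\<in>reach. b j u * x j) = (\<Sum>j<n. complex_of_real (B' $$ (j, u)) * x j)"
        proof (rule sum.mono_neutral_cong_left)
          show "\<forall>j\<in>{..<n} - reach. complex_of_real (B' $$ (j, u)) * x j = 0"
            using True by (auto simp: B'_def)
          show "b j u * x j = complex_of_real (B' $$ (j, u)) * x j" if "j \<in> reach" for j
            using that True reach_less by (simp add: B'_def of_real_b)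
        qed (use sub in auto)
        then show ?thesis using outp True by simp
      next
        \<comment> \<open>\<open>controllable\<close> quantifies over all natural numbers as inputs;
          those from \<open>m\<close> on have zero columns.\<close>
        case False
        then have "b j u = 0" for j using b[of j u] by (auto simp: inp_def)
        then show ?thesis by simp
      qed
    qed
    \<comment> \<open>The eigenvector lives on the unreachable states, where \<open>A'\<close> is
      \<open>- I\<close>, so only the eigenvalue -1 remains.\<close>
    then have nr: "i \<notin> reach" using i by blast
    have "(\<Sum>j<n. complex_of_real (A' $$ (i, j)) * x j) = (\<Sum>j<n. if j = i then - x i else 0)"
      by (rule sum.cong) (use i nr in \<open>auto simp: A'_def\<close>)
    then have "z * x i = - x i" using eig i by simp
    then have "(z + 1) * x i = 0" unfolding distrib_right by simp
    then have "z = - 1" using i by (simp add: add_eq_0_iff2)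
    then show "Re z < 0" by simp
  qed
  ultimately show ?thesis unfolding structurally_stabilizable_def by blast
qed

lemma structurally_stabilizableD:
  assumes "structurally_stabilizable A B"
  shows "i < n \<Longrightarrow> i \<notin> reach \<Longrightarrow> adj i i"
    and "T \<subseteq> reach \<Longrightarrow> card T \<le> card (\<Union>i\<in>T. nbrs i)"
proof -
  from assms obtain A' B' where rA: "symmetric_realization A A'" and rB: "realization B B'"
    and stab: "stabilizable A' B'" unfolding structurally_stabilizable_def by blast
  have A': "A' \<in> carrier_mat n n" and sym: "transpose_mat A' = A'" and B': "B' \<in> carrier_mat n m"
    using rA rB carrier_A carrier_B by (auto simp: symmetric_realization_def realization_def)
  have zero_A: "A' $$ (i, j) = 0" if "i < n" "j < n" "\<not> adj i j" for i j
    using that rA carrier_A entry.exhaust[of "A $$ (i, j)"]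
    by (auto simp: symmetric_realization_def realization_def adj_def)
  have zero_B: "B' $$ (i, u) = 0" if "i < n" "u < m" "\<not> inp i u" for i u
    using that rB carrier_B entry.exhaust[of "B $$ (i, u)"] by (auto simp: realization_def inp_def)
  have sym_A: "A' $$ (i, j) = A' $$ (j, i)" if "i < n" "j < n" for i j
  proof -
    have "transpose_mat A' $$ (i, j) = A' $$ (j, i)" using that A' by simp
    then show ?thesis by (simp add: sym)
  qed
  have unc: "Re z < 0" if "\<exists>i<n. x i \<noteq> 0"
    "\<And>i. i < n \<Longrightarrow> (\<Sum>j<n. complex_of_real (A' $$ (i, j)) * x j) = z * x i"
    "\<And>u. u < m \<Longrightarrow> (\<Sum>j<n. complex_of_real (B' $$ (j, u)) * x j) = 0" for x z
  proof -
    have "uncontrollable_eigenvalue A' B' z"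
      unfolding uncontrollable_eigenvalue_iff[OF A' sym B'] using that by blast
    then show ?thesis using stab by (simp add: stabilizable_def)
  qed
  \<comment> \<open>Test vectors found on a subset \<open>U\<close> of the states are extended by
    0.\<close>
  have extend: "(\<Sum>j<n. c j * (if j \<in> U then y j else 0)) = (\<Sum>j\<in>U. c j * y j)"
    if "U \<subseteq> {..<n}" for U and c y :: "nat \<Rightarrow> complex"
    by (rule sum.mono_neutral_cong_right) (use that in auto)
  show "adj i i" if i: "i < n" "i \<notin> reach"
  proof (rule ccontr)
    assume "\<not> adj i i"
    define U where "U = {..<n} - reach"
    have U: "finite U" "U \<subseteq> {..<n}" "i \<in> U" using i by (auto simp: U_def)
    \<comment> \<open>Cut off outside the index range, since the eigenvalue lemma asks for symmetry
      at all indices.\<close>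
    define a where "a k j = (if k < n \<and> j < n then A' $$ (k, j) else 0)" for k j
    have "\<exists>l y. 0 \<le> l \<and> (\<exists>j\<in>U. y j \<noteq> 0) \<and> (\<forall>j\<in>U. (\<Sum>k\<in>U. a j k * y k) = l * y j)"
      by (rule symmetric_nonneg_eigenvalue[OF U(1) _ U(3)])
        (use sym_A zero_A i \<open>\<not> adj i i\<close> in \<open>auto simp: a_def\<close>)
    then obtain l y where l: "0 \<le> l" and y: "\<exists>j\<in>U. y j \<noteq> 0"
      and eig: "\<And>j. j \<in> U \<Longrightarrow> (\<Sum>k\<in>U. a j k * y k) = l * y j" by blast
    define x where "x j = (if j \<in> U then complex_of_real (y j) else 0)" for j
    have "Re (complex_of_real l) < 0"
    proof (rule unc[of x])
      show "\<exists>j<n. x j \<noteq> 0" using y U(2) by (auto simp: x_def)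
      show "(\<Sum>j<n. complex_of_real (A' $$ (k, j)) * x j) = complex_of_real l * x k" if k: "k < n" for k
      proof (cases "k \<in> U")
        case True
        have "(\<Sum>j\<in>U. complex_of_real (A' $$ (k, j)) * complex_of_real (y j))
            = complex_of_real (\<Sum>j\<in>U. a k j * y j)"
          unfolding of_real_sum by (rule sum.cong) (use U(2) k in \<open>auto simp: a_def\<close>)
        then show ?thesis
          using True eig[OF True] unfolding x_def extend[OF U(2)] by simp
      next
        case False
        then have "k \<in> reach" using k by (simp add: U_def)
        then have "\<not> adj k j" if "j \<in> U" for j using that reach_adj by (auto simp: U_def)
        then have "A' $$ (k, j) = 0" if "j \<in> U" for j using that k zero_A U(2) by auto
        then show ?thesis using False unfolding x_def extend[OF U(2)] by simp
      qed
      show "(\<Sum>j<n. complex_of_real (B' $$ (j, u)) * x j) = 0" if u: "u < m" for u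
      proof -
        have "B' $$ (j, u) = 0" if "j \<in> U" for j
          using that u zero_B reach_inp by (auto simp: U_def)
        then show ?thesis unfolding x_def extend[OF U(2)] by simp
      qed
    qed
    then show False using l by simp
  qed
  show "card T \<le> card (\<Union>i\<in>T. nbrs i)" if T: "T \<subseteq> reach"
  proof (rule ccontr)
    assume less: "\<not> ?thesis"
    have Tn: "T \<subseteq> {..<n}" using T reach_less by auto
    have finT: "finite T" using T finite_reach finite_subset by blast
    let ?E = "\<Union>i\<in>T. nbrs i"
    \<comment> \<open>The entries of \<open>[A', B']\<close>, with \<open>e\<close> as column and
      \<open>i\<close> as row. Columns outside \<open>?E\<close> vanish on the rows in
      \<open>T\<close>, so fewer than \<open>card T\<close> equations remain for a left null
      vector.\<close>
    define g :: "nat + nat \<Rightarrow> nat \<Rightarrow> complex" where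
      "g e i = (case e of Inl j \<Rightarrow> complex_of_real (A' $$ (i, j)) | Inr u \<Rightarrow> complex_of_real (B' $$ (i, u)))"
      for e i
    have "\<exists>c. (\<exists>i\<in>T. c i \<noteq> 0) \<and> (\<forall>e\<in>?E. (\<Sum>i\<in>T. g e i * c i) = 0)"
      by (rule homogeneous_system_nontrivial) (use less finT finite_nbrs in auto)
    then obtain c where c: "\<exists>i\<in>T. c i \<noteq> 0" "\<And>e. e \<in> ?E \<Longrightarrow> (\<Sum>i\<in>T. g e i * c i) = 0" by blast
    define x where "x j = (if j \<in> T then c j else 0)" for j
    have "Re 0 < 0"
    proof (rule unc[of x])
      show "\<exists>j<n. x j \<noteq> 0" using c(1) Tn by (auto simp: x_def)
      show "(\<Sum>j<n. complex_of_real (A' $$ (k, j)) * x j) = 0 * x k" if k: "k < n" for k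
      proof -
        \<comment> \<open>Symmetry of \<open>A'\<close> exchanges row \<open>k\<close> for column
          \<open>k\<close>, to which the relation \<open>c\<close> applies.\<close>
        have "(\<Sum>i\<in>T. complex_of_real (A' $$ (k, i)) * c i) = (\<Sum>i\<in>T. g (Inl k) i * c i)"
          by (rule sum.cong) (use Tn k sym_A in \<open>auto simp: g_def\<close>)
        also have "\<dots> = 0"
        proof (cases "Inl k \<in> ?E")
          case True
          then show ?thesis by (rule c(2))
        next
          case False
          then have "\<not> adj i k" if "i \<in> T" for i using that by (auto simp: nbrs_def)
          then have "g (Inl k) i = 0" if "i \<in> T" for i
            using that k Tn zero_A[of i k] by (auto simp: g_def)
          then show ?thesis by simp
        qed
        finally show ?thesis unfolding x_def extend[OF Tn] by simp
      qed
      show "(\<Sum>j<n. complex_of_real (B' $$ (j, u)) * x j) = 0" if u: "u < m" for u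
      proof -
        have "(\<Sum>i\<in>T. g (Inr u) i * c i) = 0"
        proof (cases "Inr u \<in> ?E")
          case True
          then show ?thesis by (rule c(2))
        next
          case False
          then have "\<not> inp i u" if "i \<in> T" for i using that by (auto simp: nbrs_def)
          then have "g (Inr u) i = 0" if "i \<in> T" for i
            using that u Tn zero_B[of i u] by (auto simp: g_def)
          then show ?thesis by simp
        qed
        then show ?thesis unfolding x_def extend[OF Tn] by (simp add: g_def)
      qed
    qed
    then show False by simp
  qed
qed

end

theorem theorem1:
  fixes A B :: "entry mat" and n m :: nat
  assumes "A \<in> carrier_mat n n"
    and "symmetrically_structured A"
    and "B \<in> carrier_mat n m"
  shows "structurally_stabilizable A B \<longleftrightarrow>
    (\<forall>x \<in> input_unreachable A B. (x, x) \<in> edges A B) \<and>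
    (\<forall>S. S \<subseteq> input_reachable A B \<longrightarrow> card (in_neighbours A B S) \<ge> card S)"
proof -
  interpret structural_pair A B n m using assms by unfold_locales
  show ?thesis
    unfolding unreachable_loop_iff reachable_subset_card_iff
    using structurally_stabilizableI structurally_stabilizableD by blast
qed

end
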